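(* Let $K$ be a field, $S=K[x_1,\dots,x_n]$, $\mathbf{c}\in\mathbb{Z}^n$, and let $H:\mathbb{Z}^n/\mathbb{Z}\mathbf{c}\to\mathbb{N}$ be a function with finite support. Let $M,N$ be monomial ideals in $\mathbb{H}_{\mathbf{c}}(H)$ that are connected by an edge in the $T$-graph of $\mathbb{H}_{\mathbf{c}}(H)$. Then, possibly after fixing a suitable term order $\prec$ on $S$: (1) There exists an arrow map $f:\mathrm{Mon}(M)\to\mathrm{Mon}(N)$ with respect to some term order $\prec$. (2) Fix $r_1,\dots,r_n$ such that $x_i^{r_i}\in M\cap N$ for all $1\le i\le n$, and let $Q=\langle x_1^{r_1},\dots,x_n^{r_n}\rangle$. Then there also exists an arrow map $\widehat{f}:\mathrm{Mon}((Q:M))\to\mathrm{Mon}((Q:N))$ with respect to the same term order $\prec$ as in (1).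
   Context: The ring $S$ is graded by $\mathbb{Z}^n/\mathbb{Z}\mathbf{c}$ via $\deg(x_i)=\mathbf{e}_i+\mathbb{Z}\mathbf{c}$, where $\mathbf{e}_1,\dots,\mathbf{e}_n$ is the standard basis of $\mathbb{Z}^n$. $\mathbb{H}_{\mathbf{c}}(H)$ denotes the multigraded Hilbert scheme parameterizing ideals $I\subseteq S$ that are homogeneous for this grading and satisfy $\dim_K(S/I)_a=H(a)$ for all $a$. The torus $T=(K^* )^n$ acts on it via its action on $\mathbb{A}^n$; the fixed points are the monomial ideals. The $T$-graph of $\mathbb{H}_{\mathbf{c}}(H)$ has vertices the monomial ideals in $\mathbb{H}_{\mathbf{c}}(H)$, and an edge joining two (distinct) monomial ideals $M,N$ if there is a ($K$-rational) point $I\in\mathbb{H}_{\mathbf{c}}(H)$ whose $T$-orbit is one-dimensional and contains $M$ and $N$ in its closure. For a monomial ideal $M$, $\mathrm{Mon}(M)$ is the set of monomials in $M$. If two monomials $m=x^u$, $m'=x^v$ have the same degree, then $u-v=\ell\mathbf{c}$ for an integer $\ell$, and the distance is $d(m,m')=|\ell|$. Let $\prec$ be a monomial term order on $S$. A map $f:\mathrm{Mon}(M)\to\mathrm{Mon}(N)$ is an arrow map (with respect to $\prec$) if: (i) $f$ is a degree-preserving bijection such that $m\succeq f(m)$ for all $m\in\mathrm{Mon}(M)$; (ii) for all $m\in\mathrm{Mon}(M)$ and all (monomial) multiples $m'$ of $m$, $d(m',f(m'))\le d(m,f(m))$; (iii) for all $m\in\mathrm{Mon}(N)$ and all (monomial)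 multiples $m'$ of $m$, $d(f^{-1}(m'),m')\le d(f^{-1}(m),m)$. The ideal quotient is $(Q:M)=\{g\in S: gM\subseteq Q\}$. *)

theory Defs
  imports
    "HOL-Analysis.Abstract_Topology"
    "HOL-Analysis.Finite_Cartesian_Product"
    "HOL-Library.Poly_Mapping"
    "HOL-Library.Extended_Nat"
    "HOL-Library.FuncSet"
    "HOL-Algebra.Algebraic_Closure_Type"
begin

section \<open>The polynomial ring and its ideals\<close>

text \<open>
  The index type \<open>'n\<close> is the set of variables, an exponent vector is an element of \<open>nat ^ 'n\<close>,
  and the polynomial ring is the monoid algebra of the additive monoid \<open>nat ^ 'n\<close>.
\<close>

type_synonym ('n, 'k) mpoly = "(nat ^ 'n) \<Rightarrow>\<^sub>0 'k"

definition xpow :: "nat ^ 'n \<Rightarrow> ('n::finite, 'k::field) mpoly" where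
  "xpow u = Poly_Mapping.single u 1"

definition cpoly :: "'k \<Rightarrow> ('n::finite, 'k::field) mpoly" where
  "cpoly k = Poly_Mapping.single 0 k"

definition is_ideal :: "('n::finite, 'k::field) mpoly set \<Rightarrow> bool" where
  "is_ideal I \<longleftrightarrow> Modules.module.subspace (*) I"

definition ideal_gen :: "('n::finite, 'k::field) mpoly set \<Rightarrow> ('n, 'k) mpoly set" where
  "ideal_gen G = Modules.module.span (*) G"

definition ideal_quotient ::
  "('n::finite, 'k::field) mpoly set \<Rightarrow> ('n, 'k) mpoly set \<Rightarrow> ('n, 'k) mpoly set" where
  "ideal_quotient Q M = {g. \<forall>h\<in>M. g * h \<in> Q}"

definition monomial_ideal :: "('n::finite, 'k::field) mpoly set \<Rightarrow> bool" where
  "monomial_ideal M \<longleftrightarrow> (\<exists>U. M = ideal_gen (xpow ` U))"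

text \<open>Monomials are identified with their exponent vectors.\<close>

definition Mon :: "('n::finite, 'k::field) mpoly set \<Rightarrow> (nat ^ 'n) set" where
  "Mon M = {u. xpow u \<in> M}"

section \<open>The grading by \<open>\<int>\<^sup>n / \<int>c\<close>\<close>

definition cong_c :: "int ^ 'n \<Rightarrow> ((int ^ 'n) \<times> (int ^ 'n)) set" where
  "cong_c c = {(v, w). \<exists>l. w - v = l *s c}"

definition deg_group :: "int ^ 'n \<Rightarrow> (int ^ 'n) set set" where
  "deg_group c = UNIV // cong_c c"

definition int_vec :: "nat ^ 'n \<Rightarrow> int ^ 'n" where
  "int_vec u = (\<chi> i. int (u $ i))"

definition mdeg :: "int ^ 'n \<Rightarrow> nat ^ 'n \<Rightarrow> (int ^ 'n) set" where
  "mdeg c u = cong_c c `` {int_vec u}"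

definition graded_piece :: "int ^ 'n \<Rightarrow> (int ^ 'n) set \<Rightarrow> ('n::finite, 'k::field) mpoly set" where
  "graded_piece c a = {g. \<forall>u\<in>Poly_Mapping.keys g. mdeg c u = a}"

definition hom_component ::
  "int ^ 'n \<Rightarrow> (int ^ 'n) set \<Rightarrow> ('n::finite, 'k::field) mpoly \<Rightarrow> ('n, 'k) mpoly" where
  "hom_component c a g = (\<Sum>u | u \<in> Poly_Mapping.keys g \<and> mdeg c u = a. Poly_Mapping.single u (Poly_Mapping.lookup g u))"

definition homogeneous_ideal :: "int ^ 'n \<Rightarrow> ('n::finite, 'k::field) mpoly set \<Rightarrow> bool" where
  "homogeneous_ideal c I \<longleftrightarrow> is_ideal I \<and> (\<forall>g\<in>I. \<forall>a\<in>deg_group c. hom_component c a g \<in> I)"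

text \<open>
  The quotient of the \<open>K\<close>-space \<open>V\<close> by its subspace \<open>V \<inter> I\<close> has dimension \<open>d\<close>: the classes of
  some \<open>d\<close> elements of \<open>V\<close> form a basis of it.
\<close>

definition quot_has_dim ::
  "('n::finite, 'k::field) mpoly set \<Rightarrow> ('n, 'k) mpoly set \<Rightarrow> nat \<Rightarrow> bool" where
  "quot_has_dim V I d \<longleftrightarrow>
     (\<exists>B\<subseteq>V. finite B \<and> card B = d \<and>
        (\<forall>g\<in>V. \<exists>!k. k \<in> extensional B \<and> g - (\<Sum>b\<in>B. cpoly (k b) * b) \<in> I))"

section \<open>The multigraded Hilbert scheme\<close>

text \<open>The \<open>'k\<close>-rational points of the multigraded Hilbert scheme.\<close>

definition hilb :: "int ^ 'n \<Rightarrow> ((int ^ 'n) set \<Rightarrow> nat) \<Rightarrow> ('n::finite, 'k::field) mpoly set set" where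
  "hilb c H = {I. homogeneous_ideal c I \<and> (\<forall>a\<in>deg_group c. quot_has_dim (graded_piece c a) I (H a))}"

text \<open>
  The Hilbert scheme is covered by open affine charts, one for each set \<open>B\<close> of monomials: the
  chart of \<open>B\<close> consists of the ideals \<open>I\<close> such that \<open>B\<close> is a \<open>K\<close>-basis of \<open>S/I\<close>. Its coordinate
  ring is generated by the functions \<open>coord B u b\<close>, the coefficient at \<open>x\<^sup>b\<close> of the normal form of
  \<open>x\<^sup>u\<close> modulo \<open>I\<close>.
\<close>

definition chart ::
  "int ^ 'n \<Rightarrow> ((int ^ 'n) set \<Rightarrow> nat) \<Rightarrow> (nat ^ 'n) set \<Rightarrow> ('n::finite, 'k::field) mpoly set set" where
  "chart c H B = {I \<in> hilb c H. \<forall>g. \<exists>!p. Poly_Mapping.keys p \<subseteq> B \<and> g - p \<in> I}"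

definition coord ::
  "(nat ^ 'n) set \<Rightarrow> nat ^ 'n \<Rightarrow> nat ^ 'n \<Rightarrow> ('n::finite, 'k::field) mpoly set \<Rightarrow> 'k" where
  "coord B u b I = Poly_Mapping.lookup (THE p. Poly_Mapping.keys p \<subseteq> B \<and> xpow u - p \<in> I) b"

inductive_set regular_functions ::
  "(nat ^ 'n) set \<Rightarrow> (('n::finite, 'k::field) mpoly set \<Rightarrow> 'k) set"
  for B :: "(nat ^ 'n) set" where
  const: "(\<lambda>_. k) \<in> regular_functions B"
| coord: "b \<in> B \<Longrightarrow> coord B u b \<in> regular_functions B"
| add: "F \<in> regular_functions B \<Longrightarrow> G \<in> regular_functions B \<Longrightarrow>
    (\<lambda>I. F I + G I) \<in> regular_functions B"
| mult: "F \<in> regular_functions B \<Longrightarrow> G \<in> regular_functions B \<Longrightarrow>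
    (\<lambda>I. F I * G I) \<in> regular_functions B"

text \<open>
  The Zariski topology on the set of rational points, generated by the principal open subsets of
  the charts. It is the expected topology when \<open>H\<close> has finite support (so that only finite \<open>B\<close>
  have nonempty charts), and it is only used over an algebraically closed field.
\<close>

definition zariski ::
  "int ^ 'n \<Rightarrow> ((int ^ 'n) set \<Rightarrow> nat) \<Rightarrow> ('n::finite, 'k::field) mpoly set topology" where
  "zariski c H = topology_generated_by
     {{I \<in> chart c H B. F I \<noteq> 0} | B F. F \<in> regular_functions B}"

text \<open>Krull dimension (for a nonempty space).\<close>

definition irreducible_closed :: "'a topology \<Rightarrow> 'a set \<Rightarrow> bool" where
  "irreducible_closed T Z \<longleftrightarrow> closedin T Z \<and> Z \<noteq> {} \<and>
     (\<forall>A B. closedin T A \<and> closedin T B \<and> Z \<subseteq> A \<union> B \<longrightarrow> Z \<subseteq> A \<or> Z \<subseteq> B)"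

definition krull_dim :: "'a topology \<Rightarrow> enat" where
  "krull_dim T = Sup {enat d | d. \<exists>Z. (\<forall>i\<le>d. irreducible_closed T (Z i)) \<and> (\<forall>i<d. Z i \<subset> Z (Suc i))}"

section \<open>The torus action and the \<open>T\<close>-graph\<close>

text \<open>
  A torus element sends \<open>g(x\<^sub>1, \<dots>, x\<^sub>n)\<close> to \<open>g(t\<^sub>1x\<^sub>1, \<dots>, t\<^sub>nx\<^sub>n)\<close>; using the inverse of \<open>t\<close>
  instead gives the same orbits.
\<close>

definition torus :: "('k::field ^ 'n) set" where
  "torus = {t. \<forall>i. t $ i \<noteq> 0}"

definition torus_act :: "'k ^ 'n \<Rightarrow> ('n::finite, 'k::field) mpoly \<Rightarrow> ('n, 'k) mpoly" where
  "torus_act t g = Poly_Mapping.mapp (\<lambda>u a. (\<Prod>i\<in>UNIV. (t $ i) ^ (u $ i)) * a) g"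

definition torus_orbit :: "('n::finite, 'k::field) mpoly set \<Rightarrow> ('n, 'k) mpoly set set" where
  "torus_orbit I = {torus_act t ` I | t. t \<in> torus}"

definition base_change ::
  "('n::finite, 'k::field) mpoly set \<Rightarrow> ('n, 'k alg_closure) mpoly set" where
  "base_change I = ideal_gen (Poly_Mapping.map to_ac ` I)"

text \<open>
  The orbit of a \<open>K\<close>-rational point \<open>I\<close> is a locally closed subscheme of the Hilbert scheme, and
  over a small (for instance finite) field its \<open>K\<close>-rational points do not determine its dimension
  and closure. Both are therefore computed on the geometric points, i.e. over the algebraic closure
  of \<open>K\<close>; neither changes under this base change.
\<close>

definition T_edge ::
  "int ^ 'n \<Rightarrow> ((int ^ 'n) set \<Rightarrow> nat) \<Rightarrow>
   ('n::finite, 'k::field) mpoly set \<Rightarrow> ('n, 'k) mpoly set \<Rightarrow> bool" where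
  "T_edge c H M N \<longleftrightarrow>
     monomial_ideal M \<and> M \<in> hilb c H \<and> monomial_ideal N \<and> N \<in> hilb c H \<and> M \<noteq> N \<and>
     (\<exists>I \<in> hilb c H.
        krull_dim (subtopology (zariski c H) (torus_orbit (base_change I))) = 1 \<and>
        base_change M \<in> Abstract_Topology.closure_of (zariski c H) (torus_orbit (base_change I)) \<and>
        base_change N \<in> Abstract_Topology.closure_of (zariski c H) (torus_orbit (base_change I)))"

section \<open>Term orders and arrow maps\<close>

definition term_order :: "(nat ^ 'n \<Rightarrow> nat ^ 'n \<Rightarrow> bool) \<Rightarrow> bool" where
  "term_order leq \<longleftrightarrow> reflp leq \<and> transp leq \<and> antisymp leq \<and> totalp leq \<and>
     (\<forall>u. leq 0 u) \<and> (\<forall>u v w. leq u v \<longrightarrow> leq (u + w) (v + w))"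

text \<open>
  The least \<open>\<bar>l\<bar>\<close> with \<open>u - v = l c\<close>; there is exactly one such \<open>l\<close> if \<open>c \<noteq> 0\<close> and the
  monomials have the same degree. The value is irrelevant for different degrees.
\<close>

definition mdist :: "int ^ 'n \<Rightarrow> nat ^ 'n \<Rightarrow> nat ^ 'n \<Rightarrow> nat" where
  "mdist c u v = (LEAST k. \<exists>l. int_vec u - int_vec v = l *s c \<and> k = nat \<bar>l\<bar>)"

definition arrow_map ::
  "int ^ 'n \<Rightarrow> (nat ^ 'n \<Rightarrow> nat ^ 'n \<Rightarrow> bool) \<Rightarrow>
   ('n::finite, 'k::field) mpoly set \<Rightarrow> ('n, 'k) mpoly set \<Rightarrow> (nat ^ 'n \<Rightarrow> nat ^ 'n) \<Rightarrow> bool" where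
  "arrow_map c leq M N f \<longleftrightarrow>
     bij_betw f (Mon M) (Mon N) \<and>
     (\<forall>m\<in>Mon M. mdeg c (f m) = mdeg c m \<and> leq (f m) m) \<and>
     (\<forall>m\<in>Mon M. \<forall>w. mdist c (m + w) (f (m + w)) \<le> mdist c m (f m)) \<and>
     (\<forall>m\<in>Mon N. \<forall>w. mdist c (inv_into (Mon M) f (m + w)) (m + w)
                      \<le> mdist c (inv_into (Mon M) f m) m)"

end

theory Submission
  imports Defs
begin

text \<open>
  Let \<open>J\<close> be a geometric point of the orbit that joins \<open>M\<close> and \<open>N\<close>. It is homogeneous, so everything
  happens on the lines in direction \<open>c\<close>, each of which contains the monomials of one degree.

  \<^bold>\<open>The ends of an edge are opposite initial ideals.\<close> If \<open>M\<close> lies in the closure of the orbit, then the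
  orbit meets the chart of the standard monomials of \<open>M\<close>, which therefore form a basis of \<open>S/J\<close>. The
  torus scales the coordinates of \<open>J\<close> in this chart by characters that are multiples of \<open>c\<close>, and all
  of them vanish at \<open>M\<close>. Coordinates of opposite weights cannot both be nonzero, since they would
  give a nonzero constant function on the orbit. Hence every normal form modulo \<open>J\<close>
  descends in the same direction \<open>d = \<plusminus>c\<close> (\<open>initial_set_of_closure\<close>). This direction
  determines \<open>M\<close>, so that \<open>N\<close> belongs to \<open>-d\<close>, and \<open>d\<close> has entries of both signs
  (\<open>opposite_directions\<close>); a lexicographic order whose first variable is one where \<open>d\<close> is positive
  therefore ascends along \<open>d\<close>.

  \<^bold>\<open>The arrow map.\<close> In each degree, \<open>M\<close> and \<open>N\<close> now consist of the highest and of the lowest exponents of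
  the elements of \<open>J\<close>. The arrow map sends \<open>u\<close> to the lowest exponent of a shortest element of \<open>J\<close>
  with highest exponent \<open>u\<close>. Cancellation shows that the inverse arises in the same way from \<open>-d\<close>
  (\<open>partner_involution\<close>). The distance conditions hold because the length of a polynomial does not
  change under multiplication by a monomial (\<open>min_length_mult\<close>).

  \<^bold>\<open>The quotients.\<close> Because \<open>d\<close> has entries of both signs, the powers of the variables that lie in
  \<open>M \<inter> N\<close> lie in \<open>J\<close>, so that \<open>Q \<subseteq> J\<close>. The duality of \<open>S/Q\<close> shows that \<open>(Q : M)\<close> and \<open>(Q : N)\<close> are the
  opposite initial ideals of \<open>(Q : J)\<close> (\<open>tops_ideal_quotient\<close>), and the construction of the arrow map
  applies to \<open>(Q : J)\<close>.
\<close>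

(* Otherwise the dollar sign would be ambiguous between power series and vectors. *)
no_notation fps_nth (infixl "$" 75)

section \<open>Coefficients of products, and ideals of polynomials with prescribed support\<close>

abbreviation keys where "keys \<equiv> Poly_Mapping.keys"
abbreviation coef where "coef \<equiv> Poly_Mapping.lookup"

lemma coef_xpow: "coef (xpow u) v = (if u = v then 1 else 0)"
  by (simp add: xpow_def lookup_single when_def)

lemma keys_xpow [simp]: "keys (xpow u :: ('n::finite, 'k::field) mpoly) = {u}"
  by (simp add: xpow_def)

lemma poly_expansion:
  fixes g :: "('n::finite, 'k::field) mpoly"
  shows "g = (\<Sum>u\<in>keys g. cpoly (coef g u) * xpow u)"
proof -
  have "coef (\<Sum>u\<in>keys g. Poly_Mapping.single u (coef g u)) v = coef g v" for v
    by (auto simp: lookup_sum lookup_single when_def not_in_keys_iff_lookup_eq_zero)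
  then show ?thesis
    by (simp add: cpoly_def xpow_def mult_single poly_mapping_eqI)
qed

lemma coef_times_single:
  fixes g :: "('n::finite, 'k::field) mpoly"
  shows "coef (g * Poly_Mapping.single b r) k = (if b \<le> k then coef g (k - b) * r else 0)"
proof -
  have g: "g = (\<Sum>a\<in>keys g. Poly_Mapping.single a (coef g a))"
    using poly_expansion[of g] by (simp add: cpoly_def xpow_def mult_single)
  have "g * Poly_Mapping.single b r = (\<Sum>a\<in>keys g. Poly_Mapping.single (a + b) (coef g a * r))"
    by (subst g) (simp add: sum_distrib_right mult_single)
  then have *: "coef (g * Poly_Mapping.single b r) k = (\<Sum>a\<in>keys g. if a + b = k then coef g a * r else 0)"
    by (simp add: lookup_sum lookup_single when_def)
  show ?thesis
  proof (cases "b \<le> k")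
    case True
    then have "k - b + b = k"
      by (auto simp: vec_eq_iff less_eq_vec_def)
    then have "a + b = k \<longleftrightarrow> a = k - b" for a
      using add_right_cancel[of a b "k - b"] by simp
    then show ?thesis
      using True by (auto simp: * not_in_keys_iff_lookup_eq_zero)
  next
    case False
    then have "a + b \<noteq> k" for a
      by (auto simp: less_eq_vec_def)
    then show ?thesis
      using False by (simp add: *)
  qed
qed

lemma coef_times:
  fixes g h :: "('n::finite, 'k::field) mpoly"
  shows "coef (g * h) k = (\<Sum>b\<in>keys h. if b \<le> k then coef g (k - b) * coef h b else 0)"
proof -
  have h: "h = (\<Sum>b\<in>keys h. Poly_Mapping.single b (coef h b))"
    using poly_expansion[of h] by (simp add: cpoly_def xpow_def mult_single)
  have "coef (g * h) k = coef (\<Sum>b\<in>keys h. g * Poly_Mapping.single b (coef h b)) k"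
    by (subst (1) h) (simp add: sum_distrib_left)
  then show ?thesis
    by (simp add: lookup_sum coef_times_single)
qed

lemma coef_cpoly_times [simp]:
  fixes g :: "('n::finite, 'k::field) mpoly"
  shows "coef (cpoly r * g) k = r * coef g k"
proof -
  have "coef (cpoly r * g) k = coef (g * Poly_Mapping.single 0 r) k"
    by (simp add: cpoly_def mult.commute)
  also have "\<dots> = r * coef g k"
    by (simp add: coef_times_single less_eq_vec_def)
  finally show ?thesis .
qed

lemma coef_xpow_times:
  fixes g :: "('n::finite, 'k::field) mpoly"
  shows "coef (xpow w * g) (w + v) = coef g v"
proof -
  have "coef (xpow w * g) (w + v) = coef (g * Poly_Mapping.single w 1) (w + v)"
    by (simp add: xpow_def mult.commute)
  also have "\<dots> = coef g v"
    by (simp add: coef_times_single less_eq_vec_def)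
  finally show ?thesis .
qed

lemma keys_xpow_times:
  fixes g :: "('n::finite, 'k::field) mpoly"
  shows "keys (xpow w * g) = (+) w ` keys g"
proof
  show "keys (xpow w * g) \<subseteq> (+) w ` keys g"
    using keys_mult[of "xpow w" g] by auto
  show "(+) w ` keys g \<subseteq> keys (xpow w * g)"
    by (auto simp: in_keys_iff coef_xpow_times)
qed

text \<open>
  If \<open>u\<close> and \<open>v\<close> are extremal in the supports of the factors, as leading exponents are, then no other
  pair of exponents contributes to the coefficient at \<open>u + v\<close>.
\<close>

lemma coef_times_extremal:
  fixes g h :: "('n::finite, 'k::field) mpoly"
  assumes "\<And>a b. a \<in> keys g \<Longrightarrow> b \<in> keys h \<Longrightarrow> a + b = u + v \<Longrightarrow> b = v"
  shows "coef (g * h) (u + v) = coef g u * coef h v"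
proof -
  have vle: "v \<le> u + v"
    by (simp add: less_eq_vec_def)
  have "(if b \<le> u + v then coef g (u + v - b) * coef h b else 0)
      = (if b = v then coef g u * coef h v else 0)" if "b \<in> keys h" for b
  proof (cases "b = v")
    case False
    have "coef g (u + v - b) = 0" if "b \<le> u + v"
    proof (rule ccontr)
      assume "coef g (u + v - b) \<noteq> 0"
      moreover have "u + v - b + b = u + v"
        using that by (auto simp: vec_eq_iff less_eq_vec_def)
      ultimately show False
        using assms[of "u + v - b" b] \<open>b \<in> keys h\<close> False by (auto simp: in_keys_iff)
    qed
    then show ?thesis
      using False by simp
  qed (use vle in auto)
  then have "coef (g * h) (u + v) = (\<Sum>b\<in>keys h. if b = v then coef g u * coef h v else 0)"
    by (simp add: coef_times cong: sum.cong)
  then show ?thesis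
    by (simp add: in_keys_iff)
qed

lemma module_times: "Modules.module ((*) :: 'a::comm_ring_1 \<Rightarrow> 'a \<Rightarrow> 'a)"
  by unfold_locales (simp_all add: algebra_simps)

lemma is_ideal_iff:
  "is_ideal J \<longleftrightarrow> 0 \<in> J \<and> (\<forall>g\<in>J. \<forall>h\<in>J. g + h \<in> J) \<and> (\<forall>r. \<forall>g\<in>J. r * g \<in> J)"
  unfolding is_ideal_def Modules.module.subspace_def[OF module_times] by blast

lemma ideal_times: "is_ideal J \<Longrightarrow> g \<in> J \<Longrightarrow> r * g \<in> J"
  by (simp add: is_ideal_iff)

lemma ideal_diff: "is_ideal J \<Longrightarrow> g \<in> J \<Longrightarrow> h \<in> J \<Longrightarrow> g - h \<in> J"
  unfolding is_ideal_def by (rule Modules.module.subspace_diff[OF module_times])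

lemma ideal_sum: "is_ideal J \<Longrightarrow> (\<And>x. x \<in> B \<Longrightarrow> f x \<in> J) \<Longrightarrow> sum f B \<in> J"
  unfolding is_ideal_def by (rule Modules.module.subspace_sum[OF module_times])

lemma is_ideal_ideal_gen: "is_ideal (ideal_gen G)"
  unfolding is_ideal_def ideal_gen_def by (rule Modules.module.subspace_span[OF module_times])

lemma ideal_gen_base: "g \<in> G \<Longrightarrow> g \<in> ideal_gen G"
  unfolding ideal_gen_def by (rule Modules.module.span_base[OF module_times])

lemma ideal_gen_minimal: "G \<subseteq> J \<Longrightarrow> is_ideal J \<Longrightarrow> ideal_gen G \<subseteq> J"
  unfolding is_ideal_def ideal_gen_def by (rule Modules.module.span_minimal[OF module_times])

definition up_closed :: "(nat ^ 'n::finite) set \<Rightarrow> bool" where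
  "up_closed A \<longleftrightarrow> (\<forall>u\<in>A. \<forall>w. u + w \<in> A)"

definition supported :: "(nat ^ 'n::finite) set \<Rightarrow> ('n, 'k::field) mpoly set" where
  "supported A = {g. keys g \<subseteq> A}"

lemma supportedI: "(\<And>v. v \<notin> A \<Longrightarrow> coef g v = 0) \<Longrightarrow> g \<in> supported A"
  by (auto simp: supported_def in_keys_iff)

lemma supportedD: "g \<in> supported A \<Longrightarrow> v \<notin> A \<Longrightarrow> coef g v = 0"
  by (auto simp: supported_def in_keys_iff)

lemma keys_diff_subset: "keys (g - h) \<subseteq> keys g \<union> keys h"
  for g h :: "('n::finite, 'k::field) mpoly"
  by (auto simp: in_keys_iff lookup_minus)

lemma is_ideal_supported:
  assumes "up_closed A"
  shows "is_ideal (supported A :: ('n::finite, 'k::field) mpoly set)"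
proof -
  have "keys (r * g) \<subseteq> A" if "keys g \<subseteq> A" for r g :: "('n, 'k) mpoly"
  proof
    fix k assume "k \<in> keys (r * g)"
    then obtain a b where "k = a + b" "b \<in> keys g"
      using keys_mult[of r g] by blast
    then show "k \<in> A"
      using assms that unfolding up_closed_def add.commute[of a b] by blast
  qed
  moreover have "keys (g + h) \<subseteq> A" if "keys g \<subseteq> A" "keys h \<subseteq> A" for g h :: "('n, 'k) mpoly"
    using that Poly_Mapping.keys_add[of g h] by blast
  ultimately show ?thesis
    by (simp add: is_ideal_iff supported_def)
qed

lemma supported_subset_ideal:
  assumes "is_ideal J" and "\<And>u. u \<in> A \<Longrightarrow> xpow u \<in> J"
  shows "supported A \<subseteq> J"
proof
  fix g :: "('a, 'b) mpoly" assume "g \<in> supported A"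
  then have "(\<Sum>u\<in>keys g. cpoly (coef g u) * xpow u) \<in> J"
    using assms by (intro ideal_sum ideal_times) (auto simp: supported_def)
  then show "g \<in> J"
    by (simp flip: poly_expansion)
qed

lemma up_closed_Mon:
  assumes "is_ideal J"
  shows "up_closed (Mon J)"
proof -
  have "xpow (u + w) = xpow w * (xpow u :: ('a, 'b) mpoly)" for u w
    by (simp add: xpow_def mult_single add.commute)
  then show ?thesis
    using ideal_times[OF assms] by (auto simp: up_closed_def Mon_def)
qed

lemma monomial_ideal_supported:
  assumes "monomial_ideal M"
  shows "up_closed (Mon M)" "M = supported (Mon M)"
proof -
  obtain U where M: "M = ideal_gen (xpow ` U)"
    using assms unfolding monomial_ideal_def by blast
  then have id: "is_ideal M"
    by (simp add: is_ideal_ideal_gen)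
  then show up: "up_closed (Mon M)"
    by (rule up_closed_Mon)
  have "xpow ` U \<subseteq> supported (Mon M)"
    unfolding M by (auto simp: supported_def Mon_def ideal_gen_base)
  then have "M \<subseteq> supported (Mon M)"
    unfolding M by (rule ideal_gen_minimal) (use up M in \<open>auto intro: is_ideal_supported\<close>)
  then show "M = supported (Mon M)"
    using supported_subset_ideal[OF id, of "Mon M"] by (auto simp: Mon_def)
qed

text \<open>
  The exponents of the monomials in \<open>\<langle>x\<^sub>1\<^bsup>r\<^sub>1\<^esup>, \<dots>, x\<^sub>n\<^bsup>r\<^sub>n\<^esup>\<rangle>\<close>.
\<close>

definition outside_box :: "('n::finite \<Rightarrow> nat) \<Rightarrow> (nat ^ 'n) set" where
  "outside_box r = {u. \<exists>i. r i \<le> u $ i}"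

lemma up_closed_outside_box: "up_closed (outside_box r)"
  by (auto simp: up_closed_def outside_box_def intro: trans_le_add1)

lemma xpow_outside_box_in_ideal:
  fixes J :: "('n::finite, 'k::field) mpoly set"
  assumes "is_ideal J" and "\<And>i. xpow (axis i (r i)) \<in> J" and "u \<in> outside_box r"
  shows "xpow u \<in> J"
proof -
  obtain i where "r i \<le> u $ i"
    using assms(3) by (auto simp: outside_box_def)
  then have "u = axis i (r i) + (u - axis i (r i))"
    by (auto simp: vec_eq_iff axis_def)
  then have "u \<in> Mon J"
    using up_closed_Mon[OF assms(1)] assms(2)[of i] unfolding up_closed_def Mon_def
    by (metis mem_Collect_eq)
  then show ?thesis
    by (simp add: Mon_def)
qed

lemma ideal_gen_powers:
  "ideal_gen (range (\<lambda>i. xpow (axis i (r i)))) = (supported (outside_box r) :: ('n::finite, 'k::field) mpoly set)"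
  (is "ideal_gen ?G = _")
proof
  have "axis i (r i) \<in> outside_box r" for i
    unfolding outside_box_def by (intro CollectI exI[of _ i]) simp
  then show "ideal_gen ?G \<subseteq> supported (outside_box r)"
    by (intro ideal_gen_minimal[OF _ is_ideal_supported[OF up_closed_outside_box]])
      (auto simp: supported_def)
  show "supported (outside_box r) \<subseteq> ideal_gen ?G"
    by (rule supported_subset_ideal[OF is_ideal_ideal_gen xpow_outside_box_in_ideal[OF is_ideal_ideal_gen]])
      (simp_all add: ideal_gen_base)
qed

lemma Mon_ideal_quotient_supported:
  "Mon (ideal_quotient (supported B) (supported A) :: ('n::finite, 'k::field) mpoly set)
    = {u. \<forall>v\<in>A. u + v \<in> B}" (is "Mon ?Q = _")
proof (intro equalityI subsetI CollectI ballI)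
  fix u v assume "u \<in> Mon ?Q" "v \<in> A"
  then have "xpow u * xpow v \<in> (supported B :: ('n, 'k) mpoly set)"
    unfolding Mon_def ideal_quotient_def by (auto simp: supported_def)
  then show "u + v \<in> B"
    by (simp add: supported_def keys_xpow_times)
next
  fix u assume "u \<in> {u. \<forall>v\<in>A. u + v \<in> B}"
  then show "u \<in> Mon ?Q"
    by (auto simp: Mon_def ideal_quotient_def supported_def keys_xpow_times)
qed

lemma is_ideal_ideal_quotient:
  assumes "is_ideal Q" "is_ideal J"
  shows "is_ideal (ideal_quotient Q J)"
  using assms by (auto simp: is_ideal_iff ideal_quotient_def distrib_right mult.assoc)

section \<open>Exponents along a line\<close>

lemma int_vec_add [simp]: "int_vec (u + v) = int_vec u + int_vec v"
  by (simp add: int_vec_def vec_eq_iff)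

lemma int_vec_inject [simp]: "int_vec u = int_vec v \<longleftrightarrow> u = v"
  by (simp add: int_vec_def vec_eq_iff)

lemma int_vec_nth [simp]: "int_vec u $ i = int (u $ i)"
  by (simp add: int_vec_def)

text \<open>
  All the combinatorics takes place on the lines in direction \<open>d = \<plusminus>c\<close>, which consist of the
  monomials of one degree. Passing from \<open>d\<close> to \<open>-d\<close> exchanges the roles of \<open>M\<close> and \<open>N\<close>, which
  is why the direction is a parameter throughout.
\<close>

definition descent :: "int ^ 'n::finite \<Rightarrow> nat \<Rightarrow> nat ^ 'n \<Rightarrow> nat ^ 'n \<Rightarrow> bool" where
  "descent d l u v \<longleftrightarrow> int_vec u - int_vec v = int l *s d"

lemma descent_0 [simp]: "descent d 0 u v \<longleftrightarrow> u = v"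
  by (simp add: descent_def)

lemma descent_nth: "descent d l u v \<Longrightarrow> int (u $ i) = int (v $ i) + int l * d $ i"
  unfolding descent_def vec_eq_iff by (simp add: diff_eq_eq add.commute)

lemma descent_iff: "descent d l u v \<longleftrightarrow> (\<forall>i. int (u $ i) = int (v $ i) + int l * d $ i)"
  unfolding descent_def vec_eq_iff by (simp add: diff_eq_eq add.commute)

lemma descent_target_unique: "descent d l u v \<Longrightarrow> descent d l u v' \<Longrightarrow> v = v'"
  by (simp add: descent_iff vec_eq_iff)

lemma descent_source_unique: "descent d l u v \<Longrightarrow> descent d l u' v \<Longrightarrow> u = u'"
  by (simp add: descent_iff vec_eq_iff) (metis of_nat_eq_iff)

lemma descent_length_unique:
  assumes "d \<noteq> 0" "descent d l u v" "descent d l' u v"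
  shows "l = l'"
proof -
  obtain i where "d $ i \<noteq> 0"
    using assms(1) by (auto simp: vec_eq_iff)
  moreover have "int l * d $ i = int l' * d $ i"
    using assms(2,3)[THEN descent_nth, of i] by linarith
  ultimately show ?thesis
    by simp
qed

lemma descent_self: "d \<noteq> 0 \<Longrightarrow> descent d l u u \<Longrightarrow> l = 0"
  using descent_length_unique[of d l u u 0] by simp

lemma descent_trans: "descent d l u v \<Longrightarrow> descent d k v w \<Longrightarrow> descent d (l + k) u w"
  by (simp add: descent_iff distrib_right)

lemma descent_uminus: "descent (- d) l u v \<longleftrightarrow> descent d l v u"
  by (auto simp: descent_iff)

lemma descent_add: "descent d l u v \<Longrightarrow> descent d k u' v' \<Longrightarrow> descent d (l + k) (u + u') (v + v')"
  by (simp add: descent_iff distrib_right)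

lemma descent_add_right [simp]: "descent d l (w + u) (w + v) \<longleftrightarrow> descent d l u v"
  by (simp add: descent_iff)

lemma descent_subtract:
  assumes "k \<le> l" "descent d l u v" "descent d k u w"
  shows "descent d (l - k) w v"
  unfolding descent_iff
proof
  fix i
  have "int (l - k) * d $ i = int l * d $ i - int k * d $ i"
    using assms(1) by (simp add: of_nat_diff left_diff_distrib)
  then show "int (w $ i) = int (v $ i) + int (l - k) * d $ i"
    using descent_nth[OF assms(2), of i] descent_nth[OF assms(3), of i] by linarith
qed

lemma descent_multiple_of_c:
  assumes "d \<in> {c, - c}" "descent d l u v"
  obtains k where "int_vec u - int_vec v = k *s c" "nat \<bar>k\<bar> = l"
proof (cases "d = c")
  case True
  then show thesis
    using assms(2) by (intro that[of "int l"]) (auto simp: descent_def)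
next
  case False
  have "int l *s (- c) = (- int l) *s c"
    by (simp add: vec_eq_iff)
  then show thesis
    using assms False by (intro that[of "- int l"]) (auto simp: descent_def)
qed

lemma descent_mdeg:
  assumes "d \<in> {c, - c}" "descent d l u v"
  shows "mdeg c u = mdeg c v"
proof -
  obtain k where k: "int_vec u - int_vec v = k *s c"
    using descent_multiple_of_c[OF assms] .
  have "(\<exists>l. w - int_vec u = l *s c) \<longleftrightarrow> (\<exists>l. w - int_vec v = l *s c)" for w
  proof
    assume "\<exists>l. w - int_vec u = l *s c"
    then obtain l where "w - int_vec u = l *s c" ..
    then have "w - int_vec v = (l + k) *s c"
      using k by (simp add: vector_sadd_rdistrib algebra_simps)
    then show "\<exists>l. w - int_vec v = l *s c" ..
  next
    assume "\<exists>l. w - int_vec v = l *s c"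
    then obtain l where l: "w - int_vec v = l *s c" ..
    have "w - int_vec u = (w - int_vec v) - (int_vec u - int_vec v)"
      by simp
    also have "\<dots> = (l - k) *s c"
      unfolding l k by (simp add: vec_eq_iff left_diff_distrib)
    finally show "\<exists>l. w - int_vec u = l *s c" ..
  qed
  then show ?thesis
    by (auto simp: mdeg_def cong_c_def)
qed

lemma mdeg_eq_imp:
  assumes "mdeg c v = mdeg c u"
  shows "\<exists>l. int_vec u - int_vec v = l *s c"
proof -
  have "int_vec u \<in> mdeg c u"
    by (auto simp: mdeg_def cong_c_def intro: exI[of _ 0])
  then have "int_vec u \<in> mdeg c v"
    using assms by simp
  then show ?thesis
    by (simp add: mdeg_def cong_c_def)
qed

lemma mdist_eq:
  assumes "c \<noteq> 0" "int_vec u - int_vec v = k *s c"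
  shows "mdist c u v = nat \<bar>k\<bar>"
proof -
  obtain i where i: "c $ i \<noteq> 0"
    using assms(1) unfolding vec_eq_iff by auto
  have uniq: "m = k" if "int_vec u - int_vec v = m *s c" for m
  proof -
    have "m * c $ i = k * c $ i"
      using that assms(2) by (metis vector_smult_component)
    then show ?thesis
      using i by simp
  qed
  show ?thesis
    unfolding mdist_def
  proof (rule Least_equality)
    show "\<exists>l. int_vec u - int_vec v = l *s c \<and> nat \<bar>k\<bar> = nat \<bar>l\<bar>"
      using assms(2) by blast
  next
    fix y assume "\<exists>l. int_vec u - int_vec v = l *s c \<and> y = nat \<bar>l\<bar>"
    then show "nat \<bar>k\<bar> \<le> y"
      using uniq by blast
  qed
qed

lemma descent_mdist:
  assumes "d \<noteq> 0" "d \<in> {c, - c}" "descent d l u v"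
  shows "mdist c u v = l" "mdist c v u = l"
proof -
  have c: "c \<noteq> 0"
    using assms(1,2) by auto
  obtain k where k: "int_vec u - int_vec v = k *s c" "nat \<bar>k\<bar> = l"
    using descent_multiple_of_c[OF assms(2,3)] .
  show "mdist c u v = l"
    using mdist_eq[OF c k(1)] k(2) by simp
  have "int_vec v - int_vec u = - (k *s c)"
    unfolding k(1)[symmetric] by simp
  also have "\<dots> = (- k) *s c"
    by (simp add: vec_eq_iff)
  finally show "mdist c v u = l"
    using mdist_eq[OF c, of v u "- k"] k(2) by simp
qed

text \<open>
  The exponent \<open>u\<close> is the top of \<open>J\<close> in direction \<open>d\<close> if it is the highest exponent of a
  polynomial in \<open>J\<close> supported on the line through \<open>u\<close>. The tops for \<open>d\<close> and for \<open>-d\<close> are the monomials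
  of two opposite initial ideals of a homogeneous ideal \<open>J\<close>. A segment is a top together with a bound
  on the length of the support.
\<close>

definition segment :: "int ^ 'n::finite \<Rightarrow> ('n, 'k::field) mpoly set \<Rightarrow> nat ^ 'n \<Rightarrow> nat \<Rightarrow> bool" where
  "segment d J u l \<longleftrightarrow> (\<exists>g\<in>J. coef g u \<noteq> 0 \<and> (\<forall>v\<in>keys g. \<exists>k\<le>l. descent d k u v))"

definition tops :: "int ^ 'n::finite \<Rightarrow> ('n, 'k::field) mpoly set \<Rightarrow> (nat ^ 'n) set" where
  "tops d J = {u. \<exists>g\<in>J. coef g u \<noteq> 0 \<and> (\<forall>v\<in>keys g. \<exists>k. descent d k u v)}"

lemma tops_iff_segment: "u \<in> tops d J \<longleftrightarrow> (\<exists>l. segment d J u l)"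
proof
  assume "u \<in> tops d J"
  then obtain g where g: "g \<in> J" "coef g u \<noteq> 0" "\<forall>v\<in>keys g. \<exists>k. descent d k u v"
    unfolding tops_def by blast
  then obtain k where k: "\<forall>v\<in>keys g. descent d (k v) u v"
    by metis
  have "\<forall>v\<in>keys g. \<exists>j\<le>Max (k ` keys g). descent d j u v"
    using k by (auto intro!: exI[of _ "k _"])
  then show "\<exists>l. segment d J u l"
    using g unfolding segment_def by blast
next
  assume "\<exists>l. segment d J u l"
  then show "u \<in> tops d J"
    unfolding tops_def segment_def by blast
qed

definition min_length :: "int ^ 'n::finite \<Rightarrow> ('n, 'k::field) mpoly set \<Rightarrow> nat ^ 'n \<Rightarrow> nat" where
  "min_length d J u = (LEAST l. segment d J u l)"

lemma segment_min_length: "u \<in> tops d J \<Longrightarrow> segment d J u (min_length d J u)"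
  unfolding min_length_def tops_iff_segment by (rule LeastI_ex)

lemma min_length_le: "segment d J u l \<Longrightarrow> min_length d J u \<le> l"
  unfolding min_length_def by (rule Least_le)

text \<open>
  Multiplication by a monomial translates a polynomial without changing its length. This is where
  the monotonicity conditions on an arrow map come from.
\<close>

lemma min_length_mult:
  assumes "is_ideal J" "u \<in> tops d J"
  shows "u + w \<in> tops d J" "min_length d J (u + w) \<le> min_length d J u"
proof -
  obtain g where g: "g \<in> J" "coef g u \<noteq> 0"
      "\<forall>v\<in>keys g. \<exists>k\<le>min_length d J u. descent d k u v"
    using segment_min_length[OF assms(2)] unfolding segment_def by blast
  have "segment d J (u + w) (min_length d J u)"
    unfolding segment_def
  proof (intro bexI conjI)
    show "xpow w * g \<in> J"
      by (rule ideal_times[OF assms(1) g(1)])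
    show "coef (xpow w * g) (u + w) \<noteq> 0"
      using g(2) by (simp add: add.commute[of u] coef_xpow_times)
    show "\<forall>v\<in>keys (xpow w * g). \<exists>k\<le>min_length d J u. descent d k (u + w) v"
      using g(3) by (simp add: keys_xpow_times add.commute[of u])
  qed
  then show "u + w \<in> tops d J" "min_length d J (u + w) \<le> min_length d J u"
    by (auto simp: tops_iff_segment intro: min_length_le)
qed

text \<open>
  The lowest exponent of a shortest polynomial with top \<open>u\<close>. The value is meaningful for tops, where
  such an exponent exists and is unique.
\<close>

definition partner :: "int ^ 'n::finite \<Rightarrow> ('n, 'k::field) mpoly set \<Rightarrow> nat ^ 'n \<Rightarrow> nat ^ 'n" where
  "partner d J u = (SOME v. descent d (min_length d J u) u v)"

text \<open>
  Pairing each top \<open>u\<close> with the lowest exponent \<open>v\<close> of a shortest polynomial \<open>g\<close> below it is an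
  involution: if some \<open>h \<in> J\<close> with lowest exponent \<open>v\<close> were shorter than \<open>g\<close>, then a combination
  of \<open>g\<close> and \<open>h\<close> would cancel \<open>v\<close> and keep \<open>u\<close>, and would be shorter than \<open>g\<close>.
\<close>

lemma partner_involution:
  fixes J :: "('n::finite, 'k::field) mpoly set"
  assumes J: "is_ideal J" and d: "d \<noteq> 0" and u: "u \<in> tops d J"
  shows "descent d (min_length d J u) u (partner d J u)"
    and "partner d J u \<in> tops (- d) J"
    and "min_length (- d) J (partner d J u) = min_length d J u"
    and "partner (- d) J (partner d J u) = u"
proof -
  define l where "l = min_length d J u"
  obtain g where g: "g \<in> J" "coef g u \<noteq> 0" "\<forall>v\<in>keys g. \<exists>k\<le>l. descent d k u v"
    using segment_min_length[OF u] unfolding segment_def l_def by blast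
  \<comment> \<open>By minimality a polynomial with top \<open>u\<close> cannot miss the lower end of its segment.\<close>
  have shorter: False
    if h: "h \<in> J" "coef h u \<noteq> 0" "\<forall>v\<in>keys h. \<exists>k\<le>l. descent d k u v"
      and no: "\<forall>v\<in>keys h. \<not> descent d l u v" for h
  proof -
    have *: "\<exists>k<l. descent d k u v" if "v \<in> keys h" for v
      using h(3) no that by (metis le_neq_implies_less)
    have "u \<in> keys h"
      using h(2) by (simp add: in_keys_iff)
    with * have "l > 0"
      by force
    have "segment d J u (l - 1)"
      unfolding segment_def
    proof (intro bexI[of _ h] conjI ballI)
      fix v assume "v \<in> keys h"
      then show "\<exists>k\<le>l - 1. descent d k u v"
        using * \<open>l > 0\<close> by (metis One_nat_def Suc_pred less_Suc_eq_le)
    qed (use h in auto)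
    then show False
      using min_length_le[of d J u "l - 1"] \<open>l > 0\<close> by (simp flip: l_def)
  qed
  obtain v where v: "v \<in> keys g" "descent d l u v"
    using shorter[OF g] by blast
  have part: "partner d J u = v"
    unfolding partner_def using v(2) by (auto simp flip: l_def intro: descent_target_unique)
  have seg: "segment (- d) J v l"
    unfolding segment_def
  proof (intro bexI[of _ g] conjI ballI)
    fix w assume "w \<in> keys g"
    then obtain k where "k \<le> l" "descent d k u w"
      using g(3) by blast
    then show "\<exists>k\<le>l. descent (- d) k v w"
      using descent_subtract[OF _ v(2)] by (intro exI[of _ "l - k"]) (simp add: descent_uminus)
  qed (use g v in \<open>auto simp: in_keys_iff\<close>)
  have "\<not> min_length (- d) J v < l"
  proof
    assume less: "min_length (- d) J v < l"
    have "v \<in> tops (- d) J"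
      using seg tops_iff_segment by blast
    then have "segment (- d) J v (min_length (- d) J v)"
      by (rule segment_min_length)
    then obtain h where h: "h \<in> J" "coef h v \<noteq> 0"
        "\<forall>w\<in>keys h. \<exists>k\<le>min_length (- d) J v. descent d k w v"
      unfolding segment_def descent_uminus by blast
    define q where "q = g - cpoly (coef g v / coef h v) * h"
    have keys_q: "keys q \<subseteq> keys g \<union> keys h"
      unfolding q_def by (auto simp: in_keys_iff lookup_minus)
    have "coef h u = 0"
    proof (rule ccontr)
      assume "coef h u \<noteq> 0"
      then have "u \<in> keys h"
        by (simp add: in_keys_iff)
      then obtain k where "k \<le> min_length (- d) J v" "descent d k u v"
        using h(3) by blast
      then show False
        using descent_length_unique[OF d v(2), of k] less by simp
    qed
    then have qu: "coef q u \<noteq> 0"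
      using g(2) by (simp add: q_def lookup_minus)
    have qv: "coef q v = 0"
      using h(2) by (simp add: q_def lookup_minus)
    have "\<exists>k\<le>l. descent d k u w" if w: "w \<in> keys h" for w
    proof -
      obtain k where k: "k \<le> min_length (- d) J v" "descent d k w v"
        using h(3) w by blast
      then have "descent (- d) (l - k) w u"
        using less v(2) by (intro descent_subtract[of k l "- d" v]) (simp_all add: descent_uminus)
      then show ?thesis
        unfolding descent_uminus by (intro exI[of _ "l - k"]) simp
    qed
    then have "\<forall>w\<in>keys q. \<exists>k\<le>l. descent d k u w"
      using g(3) keys_q by blast
    moreover have "q \<in> J"
      unfolding q_def using J g(1) h(1) by (intro ideal_diff ideal_times)
    moreover have "\<forall>w\<in>keys q. \<not> descent d l u w"
      using qv descent_target_unique[OF v(2)] by (auto simp: in_keys_iff)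
    ultimately show False
      using shorter[of q] qu by blast
  qed
  then have len: "min_length (- d) J v = l"
    using min_length_le[OF seg] by simp
  show "descent d (min_length d J u) u (partner d J u)"
    using v(2) by (simp add: part l_def)
  show "partner d J u \<in> tops (- d) J"
    unfolding part using seg tops_iff_segment by blast
  show "min_length (- d) J (partner d J u) = min_length d J u"
    by (simp add: part len l_def)
  show "partner (- d) J (partner d J u) = u"
    unfolding part partner_def[of "- d"] len descent_uminus
    using v(2) by (auto intro: descent_source_unique)
qed

text \<open>
  The ideal \<open>J\<close> may live over a larger field than \<open>M\<close> and \<open>N\<close>, because an arrow map depends only on the
  exponents.
\<close>

lemma arrow_map_of_tops:
  fixes J :: "('n::finite, 'f::field) mpoly set" and M N :: "('n, 'k::field) mpoly set"
  assumes J: "is_ideal J" and d: "d \<noteq> 0" "d \<in> {c, - c}"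
    and M: "Mon M = tops d J" and N: "Mon N = tops (- d) J"
    and leq: "\<And>l u v. descent d l u v \<Longrightarrow> leq v u"
  shows "arrow_map c leq M N (partner d J)"
proof -
  have d': "- d \<noteq> 0" "- d \<in> {c, - c}"
    using d by auto
  note down = partner_involution[OF J d(1)] and up = partner_involution[OF J d'(1), simplified]
  have bij: "bij_betw (partner d J) (Mon M) (Mon N)"
    unfolding M N by (rule bij_betwI[where g = "partner (- d) J"]) (auto simp: down up)
  have inv: "inv_into (Mon M) (partner d J) v = partner (- d) J v" if "v \<in> tops (- d) J" for v
    using that bij up by (intro inv_into_f_eq) (auto simp: bij_betw_def M)
  have dist: "mdist c u (partner d J u) = min_length d J u" if "u \<in> tops d J" for u
    using descent_mdist(1)[OF d down(1)[OF that]] .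
  have dist': "mdist c (partner (- d) J v) v = min_length (- d) J v" if "v \<in> tops (- d) J" for v
    using descent_mdist(2)[OF d' up(1)[OF that]] .
  show ?thesis
    unfolding arrow_map_def
  proof (intro conjI ballI allI)
    show "bij_betw (partner d J) (Mon M) (Mon N)"
      by (rule bij)
  next
    fix u w assume "u \<in> Mon M"
    then have u: "u \<in> tops d J"
      by (simp add: M)
    show "mdeg c (partner d J u) = mdeg c u"
      using descent_mdeg[OF d(2) down(1)[OF u]] by simp
    show "leq (partner d J u) u"
      by (rule leq[OF down(1)[OF u]])
    show "mdist c (u + w) (partner d J (u + w)) \<le> mdist c u (partner d J u)"
      using min_length_mult[OF J u] by (simp add: dist u)
  next
    fix v w assume "v \<in> Mon N"
    then have v: "v \<in> tops (- d) J"
      by (simp add: N)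
    show "mdist c (inv_into (Mon M) (partner d J) (v + w)) (v + w)
        \<le> mdist c (inv_into (Mon M) (partner d J) v) v"
      using min_length_mult[OF J v] by (simp add: dist' inv v)
  qed
qed

text \<open>
  A lexicographic order ascends along \<open>d\<close> if its most significant variable is one in which \<open>d\<close> is
  positive.
\<close>

lemma term_order_ascending:
  fixes d :: "int ^ 'n::finite"
  assumes "d $ p > 0"
  obtains leq where "term_order leq" "\<forall>l u v. descent d l u v \<longrightarrow> leq v u"
proof -
  obtain rk0 :: "'n \<Rightarrow> nat" where "inj rk0"
    using finite_imp_inj_to_nat_seg[of "UNIV :: 'n set"] by auto
  define rk where "rk i = (if i = p then 0 else Suc (rk0 i))" for i
  have rk: "inj rk" "\<And>i. i \<noteq> p \<Longrightarrow> rk p < rk i"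
    using \<open>inj rk0\<close> by (auto simp: rk_def inj_on_def)
  define less where "less u v \<longleftrightarrow> (\<exists>i. u $ i < v $ i \<and> (\<forall>j. rk j < rk i \<longrightarrow> u $ j = v $ j))"
    for u v :: "nat ^ 'n"
  have irrefl: "\<not> less u u" for u
    by (simp add: less_def)
  have trans: "less u w" if uv: "less u v" and vw: "less v w" for u v w
  proof -
    obtain i where i: "u $ i < v $ i" "\<And>j. rk j < rk i \<Longrightarrow> u $ j = v $ j"
      using uv unfolding less_def by blast
    obtain k where k: "v $ k < w $ k" "\<And>j. rk j < rk k \<Longrightarrow> v $ j = w $ j"
      using vw unfolding less_def by blast
    show ?thesis
    proof (cases "rk i < rk k")
      case True
      then show ?thesis
        unfolding less_def using i k by (intro exI[of _ i]) auto
    next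
      case False
      then have "rk k < rk i \<or> i = k"
        using rk(1) by (metis injD linorder_neqE_nat)
      then show ?thesis
        unfolding less_def using i k by (intro exI[of _ k]) auto
    qed
  qed
  have total: "less u v \<or> less v u" if neq: "u \<noteq> v" for u v
  proof -
    obtain i where "u $ i \<noteq> v $ i"
      using neq unfolding vec_eq_iff by blast
    then obtain k where k: "u $ k \<noteq> v $ k" "\<And>j. rk j < rk k \<Longrightarrow> u $ j = v $ j"
      using ex_has_least_nat[of "\<lambda>i. u $ i \<noteq> v $ i" i rk] by (metis not_le)
    then show ?thesis
      unfolding less_def by (metis linorder_neqE_nat)
  qed
  have zero: "\<not> less u 0" for u
    by (simp add: less_def)
  have add: "less (u + w) (v + w)" if "less u v" for u v w
    using that by (simp add: less_def)
  define leq where "leq u v \<longleftrightarrow> u = v \<or> less u v" for u v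
  have "term_order leq"
    unfolding term_order_def
  proof (intro conjI allI impI)
    show "reflp leq"
      by (rule reflpI) (simp add: leq_def)
    show "transp leq"
      by (rule transpI) (use trans in \<open>unfold leq_def, blast\<close>)
    show "antisymp leq"
      by (rule antisympI) (use irrefl trans in \<open>unfold leq_def, blast\<close>)
    show "totalp leq"
      by (rule totalpI) (use total in \<open>unfold leq_def, blast\<close>)
    show "leq 0 u" for u
      using zero total by (auto simp: leq_def)
    show "leq (u + w) (v + w)" if "leq u v" for u v w
      using that add by (auto simp: leq_def)
  qed
  moreover have "leq v u" if "descent d l u v" for l u v
  proof (cases "l = 0")
    case False
    have "int (u $ p) = int (v $ p) + int l * d $ p"
      by (rule descent_nth[OF that])
    then have "v $ p < u $ p"
      using False assms mult_pos_pos[of "int l" "d $ p"] by linarith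
    then show ?thesis
      unfolding leq_def less_def using rk by (metis not_less_iff_gr_or_eq)
  qed (use that in \<open>simp add: leq_def\<close>)
  ultimately show thesis
    by (intro that[of leq]) auto
qed

section \<open>Initial sets\<close>

text \<open>
  The initial ideal of \<open>J\<close> for an order that ascends along \<open>d\<close>, described by its normal forms instead
  of by the order: \<open>d\<close> and \<open>-d\<close> can then be treated alike, before it is known that both of
  them are compatible with a term order.
\<close>

definition initial_set :: "int ^ 'n::finite \<Rightarrow> ('n, 'k::field) mpoly set \<Rightarrow> (nat ^ 'n) set \<Rightarrow> bool" where
  "initial_set d J A \<longleftrightarrow>
     (\<forall>p\<in>J. keys p \<subseteq> - A \<longrightarrow> p = 0) \<and>
     (\<forall>u\<in>A. \<exists>p. keys p \<subseteq> - A \<and> (\<forall>b\<in>keys p. \<exists>l>0. descent d l u b) \<and> xpow u - p \<in> J)"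

text \<open>
  The normal forms of the monomials extend linearly to all polynomials. The extension maps \<open>J\<close> to \<open>0\<close>,
  since the normal form of an element of \<open>J\<close> is an element of \<open>J\<close> without monomials in \<open>A\<close>.
\<close>

lemma initial_set_normal_forms:
  fixes J :: "('n::finite, 'k::field) mpoly set"
  assumes init: "initial_set d J A" and J: "is_ideal J"
  obtains nf :: "nat ^ 'n \<Rightarrow> ('n, 'k) mpoly"
  where "\<forall>u. keys (nf u) \<subseteq> - A"
    and "\<forall>u. \<forall>b\<in>keys (nf u). \<exists>l. descent d l u b"
    and "\<forall>u. u \<notin> A \<longrightarrow> nf u = xpow u"
    and "\<forall>h\<in>J. (\<Sum>v\<in>keys h. cpoly (coef h v) * nf v) = 0"
proof -
  have "\<exists>p. keys p \<subseteq> - A \<and> (\<forall>b\<in>keys p. \<exists>l. descent d l u b) \<and> xpow u - p \<in> J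
      \<and> (u \<notin> A \<longrightarrow> p = xpow u)" for u
  proof (cases "u \<in> A")
    case True
    then show ?thesis
      using init unfolding initial_set_def by blast
  next
    case False
    then show ?thesis
      using J by (intro exI[of _ "xpow u"]) (auto simp: is_ideal_iff intro: exI[of _ 0])
  qed
  then obtain nf where nf: "\<And>u. keys (nf u) \<subseteq> - A"
      "\<And>u b. b \<in> keys (nf u) \<Longrightarrow> \<exists>l. descent d l u b"
      "\<And>u. xpow u - nf u \<in> J" "\<And>u. u \<notin> A \<Longrightarrow> nf u = xpow u"
    by metis
  have "(\<Sum>v\<in>keys h. cpoly (coef h v) * nf v) = 0" (is "?s = 0") if h: "h \<in> J" for h
  proof -
    have "(\<Sum>v\<in>keys h. cpoly (coef h v) * (xpow v - nf v)) \<in> J"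
      by (intro ideal_sum ideal_times J nf)
    also have "(\<Sum>v\<in>keys h. cpoly (coef h v) * (xpow v - nf v)) = h - ?s"
      by (simp add: right_diff_distrib sum_subtractf flip: poly_expansion)
    finally have "h - (h - ?s) \<in> J"
      by (rule ideal_diff[OF J h])
    then have "?s \<in> J"
      by simp
    moreover have "keys ?s \<subseteq> - A"
    proof
      fix k assume "k \<in> keys ?s"
      then have "(\<Sum>v\<in>keys h. coef h v * coef (nf v) k) \<noteq> 0"
        by (simp add: in_keys_iff lookup_sum)
      then obtain v where "coef h v * coef (nf v) k \<noteq> 0"
        by (rule sum.not_neutral_contains_not_neutral)
      then show "k \<in> - A"
        using nf(1)[of v] by (auto simp: in_keys_iff)
    qed
    ultimately show ?thesis
      using init unfolding initial_set_def by blast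
  qed
  with nf show thesis
    by (intro that[of nf]) auto
qed

text \<open>
  If \<open>u \<notin> A\<close> were the top of \<open>g \<in> J\<close>, then taking normal forms would keep the term of \<open>g\<close> at \<open>u\<close>, as all
  other terms lie below \<open>u\<close> and only move down, although the normal form of \<open>g\<close> is \<open>0\<close>.
\<close>

lemma tops_initial_set:
  fixes J :: "('n::finite, 'k::field) mpoly set"
  assumes init: "initial_set d J A" and J: "is_ideal J" and d: "d \<noteq> 0"
  shows "tops d J = A"
proof (intro equalityI subsetI)
  fix u assume "u \<in> tops d J"
  then obtain g where g: "g \<in> J" "coef g u \<noteq> 0" "\<forall>v\<in>keys g. \<exists>k. descent d k u v"
    unfolding tops_def by blast
  obtain nf :: "nat ^ 'n \<Rightarrow> ('n, 'k) mpoly"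
    where nf': "\<forall>u. keys (nf u) \<subseteq> - A" "\<forall>u. \<forall>b\<in>keys (nf u). \<exists>l. descent d l u b"
      "\<forall>u. u \<notin> A \<longrightarrow> nf u = xpow u"
      "\<forall>h\<in>J. (\<Sum>v\<in>keys h. cpoly (coef h v) * nf v) = 0"
    by (rule initial_set_normal_forms[OF init J])
  note nf = nf'[rule_format]
  show "u \<in> A"
  proof (rule ccontr)
    assume "u \<notin> A"
    have "coef g v * coef (nf v) u = (if v = u then coef g u else 0)" if v: "v \<in> keys g" for v
    proof (cases "v = u")
      case False
      have "u \<notin> keys (nf v)"
      proof
        assume "u \<in> keys (nf v)"
        then obtain l where l: "descent d l v u"
          using nf(2) by blast
        obtain k where k: "descent d k u v"
          using g(3) v by blast
        then have "k + l = 0"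
          using descent_self[OF d descent_trans[OF k l]] by simp
        then show False
          using False l by simp
      qed
      then show ?thesis
        using False by (simp add: not_in_keys_iff_lookup_eq_zero)
    qed (use nf(3) \<open>u \<notin> A\<close> in \<open>simp add: coef_xpow\<close>)
    then have "coef (\<Sum>v\<in>keys g. cpoly (coef g v) * nf v) u
        = (\<Sum>v\<in>keys g. if v = u then coef g u else 0)"
      by (simp add: lookup_sum cong: sum.cong)
    also have "\<dots> = coef g u"
      using g(2) by (simp add: in_keys_iff)
    finally show False
      using nf(4)[OF g(1)] g(2) by simp
  qed
next
  fix u assume u: "u \<in> A"
  then obtain p where p: "keys p \<subseteq> - A" "\<forall>b\<in>keys p. \<exists>l>0. descent d l u b" "xpow u - p \<in> J"
    using init unfolding initial_set_def by blast
  have "u \<notin> keys p"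
    using p(1) u by blast
  then have "coef (xpow u - p) u \<noteq> 0"
    by (simp add: lookup_minus coef_xpow in_keys_iff)
  moreover have "\<exists>k. descent d k u v" if "v \<in> keys (xpow u - p)" for v
  proof (cases "v = u")
    case True
    then show ?thesis
      by (intro exI[of _ 0]) simp
  next
    case False
    then have "v \<in> keys p"
      using that keys_diff_subset[of "xpow u" p] by auto
    then show ?thesis
      using p(2) by blast
  qed
  ultimately show "u \<in> tops d J"
    unfolding tops_def using p(3) by blast
qed

text \<open>
  If \<open>d\<close> has no positive entry, then descending along \<open>d\<close> multiplies by monomials, and so stays
  inside \<open>A\<close>; hence the normal forms of the monomials in \<open>A\<close> vanish.
\<close>

lemma initial_set_nonpos:
  assumes init: "initial_set d J A" and A: "up_closed A" and d: "\<And>i. d $ i \<le> 0"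
  shows "initial_set e J A"
proof -
  have "p = 0" if "u \<in> A" "keys p \<subseteq> - A" and p: "\<forall>b\<in>keys p. \<exists>l>0. descent d l u b" for u p
  proof (rule ccontr)
    assume "p \<noteq> 0"
    then obtain b where b: "b \<in> keys p"
      by (metis keys_eq_empty ex_in_conv)
    then obtain l where "descent d l u b"
      using p by blast
    then have "u $ i \<le> b $ i" for i
      using descent_nth[of d l u b i] d[of i] mult_nonneg_nonpos[of "int l" "d $ i"] by simp
    then have "b = u + (b - u)"
      by (simp add: vec_eq_iff)
    then have "b \<in> A"
      using A \<open>u \<in> A\<close> unfolding up_closed_def by metis
    then show False
      using b that(2) by blast
  qed
  then show ?thesis
    using init unfolding initial_set_def by (metis ComplD empty_iff keys_zero subsetI)
qed

text \<open>
  Two different monomial ideals that are each initial for \<open>c\<close> or \<open>-c\<close> are initial for opposite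
  directions, because the tops of \<open>J\<close> determine the initial set. Moreover \<open>c\<close> has entries of both
  signs, since otherwise one of the two ideals would be initial for both directions.
\<close>

lemma opposite_directions:
  fixes J :: "('n::finite, 'k::field) mpoly set"
  assumes J: "is_ideal J" and A: "up_closed A" and B: "up_closed B" and "A \<noteq> B"
    and initA: "initial_set c J A \<or> initial_set (- c) J A"
    and initB: "initial_set c J B \<or> initial_set (- c) J B"
  obtains d p q where "d \<in> {c, - c}" "initial_set d J A" "initial_set (- d) J B"
    "d $ p > 0" "d $ q < 0"
proof -
  have neq: False if "d \<noteq> 0" "initial_set d J A" "initial_set d J B" for d
    using that tops_initial_set[OF _ J] \<open>A \<noteq> B\<close> by blast
  obtain d where d: "d \<in> {c, - c}" "initial_set d J A"
    using initA by blast
  have "d \<noteq> 0"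
  proof
    assume "d = 0"
    then have "c = 0"
      using d(1) by auto
    \<comment> \<open>Any nonzero direction will do in place of \<open>0\<close>.\<close>
    then have "initial_set 1 J A" "initial_set 1 J B"
      using initA initB A B by (auto intro: initial_set_nonpos[of 0])
    moreover have "(1 :: int ^ 'n) \<noteq> 0"
      by (simp add: vec_eq_iff)
    ultimately show False
      using neq by blast
  qed
  then have initB': "initial_set (- d) J B"
    using neq[OF _ d(2)] initB d(1) by auto
  have "\<exists>p. d $ p > 0"
  proof (rule ccontr)
    assume "\<not> (\<exists>p. d $ p > 0)"
    then have "initial_set (- d) J A"
      using initial_set_nonpos[OF d(2) A] by (simp add: not_less)
    then show False
      using neq[of "- d"] initB' \<open>d \<noteq> 0\<close> by simp
  qed
  moreover have "\<exists>q. d $ q < 0"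
  proof (rule ccontr)
    assume "\<not> (\<exists>q. d $ q < 0)"
    then have "initial_set d J B"
      using initial_set_nonpos[OF initB' B] by (simp add: not_less)
    then show False
      using neq d(2) \<open>d \<noteq> 0\<close> by blast
  qed
  ultimately show thesis
    using that d initB' by blast
qed

lemma initial_power_in_ideal:
  assumes init: "initial_set d J A" and "axis i r \<in> A" and "d $ p > 0" and "p \<noteq> i"
  shows "xpow (axis i r) \<in> J"
proof -
  obtain g where g: "\<forall>b\<in>keys g. \<exists>l>0. descent d l (axis i r) b" "xpow (axis i r) - g \<in> J"
    using init assms(2) unfolding initial_set_def by blast
  have "\<not> descent d l (axis i r) b" if "l > 0" for l b
  proof
    assume "descent d l (axis i r) b"
    then have "0 = int (b $ p) + int l * d $ p"
      using descent_nth[of d l "axis i r" b p] assms(4) by (simp add: axis_def)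
    moreover have "int l * d $ p > 0"
      using assms(3) that by simp
    ultimately show False
      by linarith
  qed
  then have "g = 0"
    using g(1) by (metis keys_eq_empty ex_in_conv)
  then show ?thesis
    using g(2) by simp
qed

text \<open>
  Along a direction with entries of both signs, a power of a variable can be moved in at most one
  of the two senses without leaving the positive orthant.
\<close>

lemma common_power_in_ideal:
  assumes "initial_set d J A" "initial_set (- d) J B" "d $ p > 0" "d $ q < 0"
    and "axis i r \<in> A" "axis i r \<in> B"
  shows "xpow (axis i r) \<in> J"
proof (cases "p = i")
  case True
  then have "q \<noteq> i"
    using assms(3,4) by auto
  then show ?thesis
    using assms(2,4,6) by (intro initial_power_in_ideal[of "- d" J B i r q]) auto
next
  case False
  then show ?thesis
    using assms(1,3,5) by (intro initial_power_in_ideal[of d J A i r p]) auto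
qed

section \<open>Linkage\<close>

text \<open>
  The corner of the box, whose monomial spans the socle of \<open>S/Q\<close>; it is meaningful when all
  exponents are positive.
\<close>

definition corner :: "('n::finite \<Rightarrow> nat) \<Rightarrow> nat ^ 'n" where
  "corner r = (\<chi> i. r i - 1)"

lemma finite_below: "finite {a :: nat ^ 'n::finite. a \<le> k}"
proof -
  have "a \<in> vec_lambda ` Pi\<^sub>E UNIV (\<lambda>i. {..k $ i})" if "a \<le> k" for a :: "nat ^ 'n"
    using that by (intro image_eqI[of _ _ "vec_nth a"]) (auto simp: less_eq_vec_def vec_nth_inverse)
  then have "{a. a \<le> k} \<subseteq> vec_lambda ` Pi\<^sub>E UNIV (\<lambda>i. {..k $ i})"
    by blast
  moreover have "finite (vec_lambda ` Pi\<^sub>E UNIV (\<lambda>i. {..k $ i}))"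
    by (intro finite_imageI finite_PiE) auto
  ultimately show ?thesis
    by (rule finite_subset)
qed

lemma le_corner_iff:
  assumes "u \<notin> outside_box r"
  shows "v \<le> corner r \<longleftrightarrow> v \<notin> outside_box r"
proof -
  have "r i > 0" for i
    using assms by (metis (mono_tags, lifting) mem_Collect_eq outside_box_def gr0I le0)
  then have "v $ i \<le> r i - 1 \<longleftrightarrow> \<not> r i \<le> v $ i" for i
    by (metis Suc_diff_1 less_Suc_eq_le not_le)
  then show ?thesis
    by (simp add: corner_def less_eq_vec_def outside_box_def)
qed

text \<open>
  Taking the initial ideal commutes with the quotient \<open>(Q : J)\<close>. The substantial inclusion is an
  explicit form of the Gorenstein duality of \<open>S/Q\<close>: under the pairing \<open>(g, h) \<mapsto> coef (g * h) \<rho>\<close>,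
  with \<open>\<rho>\<close> the corner of the box, \<open>(Q : J)\<close> is the annihilator of \<open>J\<close>. So, for a standard monomial
  \<open>w\<close>, the coefficient at \<open>w\<close> of the normal form modulo \<open>J\<close>, a linear functional that vanishes on
  \<open>J\<close>, is represented by an element of \<open>(Q : J)\<close>. That element has top \<open>\<rho> - w\<close>, since taking
  normal forms never ascends.
\<close>

lemma tops_ideal_quotient:
  fixes J :: "('n::finite, 'k::field) mpoly set"
  assumes init: "initial_set d J A" and J: "is_ideal J" and d: "d \<noteq> 0"
    and pow: "\<And>i. xpow (axis i (r i)) \<in> J"
  shows "tops d (ideal_quotient (supported (outside_box r)) J) = {u. \<forall>v\<in>A. u + v \<in> outside_box r}"
    (is "tops d ?QJ = _")
proof (intro equalityI subsetI CollectI ballI)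
  fix u v assume "u \<in> tops d ?QJ" and "v \<in> A"
  then have "v \<in> tops d J"
    using tops_initial_set[OF init J d] by simp
  then obtain h where h: "h \<in> J" "coef h v \<noteq> 0" "\<forall>b\<in>keys h. \<exists>k. descent d k v b"
    unfolding tops_def by blast
  obtain g where g: "g \<in> ?QJ" "coef g u \<noteq> 0" "\<forall>a\<in>keys g. \<exists>k. descent d k u a"
    using \<open>u \<in> tops d ?QJ\<close> unfolding tops_def by blast
  have "b = v" if ab: "a \<in> keys g" "b \<in> keys h" "a + b = u + v" for a b
  proof -
    obtain k l where kl: "descent d k u a" "descent d l v b"
      using ab(1,2) g(3) h(3) by blast
    then have "k + l = 0"
      using descent_self[OF d] descent_add ab(3) by metis
    then show ?thesis
      using kl(2) by simp
  qed
  then have "coef (g * h) (u + v) = coef g u * coef h v"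
    by (rule coef_times_extremal)
  moreover have "g * h \<in> supported (outside_box r)"
    using g(1) h(1) by (simp add: ideal_quotient_def)
  ultimately show "u + v \<in> outside_box r"
    using g(2) h(2) supportedD[of "g * h" "outside_box r" "u + v"] by auto
next
  fix u assume u: "u \<in> {u. \<forall>v\<in>A. u + v \<in> outside_box r}"
  show "u \<in> tops d ?QJ"
  proof (cases "u \<in> outside_box r")
    case True
    then have "xpow u * h \<in> supported (outside_box r)" for h :: "('n, 'k) mpoly"
      using up_closed_outside_box[of r]
      by (auto simp: supported_def keys_xpow_times up_closed_def)
    then have "xpow u \<in> ?QJ"
      by (simp add: ideal_quotient_def)
    then show ?thesis
      unfolding tops_def by (auto simp: coef_xpow intro!: bexI[of _ "xpow u"] exI[of _ 0])
  next
    case False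
    note box = le_corner_iff[OF False]
    define w where "w = corner r - u"
    have ule: "u \<le> corner r"
      using False box by simp
    then have uw: "u + w = corner r"
      by (auto simp: w_def vec_eq_iff less_eq_vec_def)
    have "corner r \<notin> outside_box r"
      using box by blast
    then have "w \<notin> A"
      using u uw by auto
    obtain nf :: "nat ^ 'n \<Rightarrow> ('n, 'k) mpoly"
      where nf': "\<forall>u. keys (nf u) \<subseteq> - A" "\<forall>u. \<forall>b\<in>keys (nf u). \<exists>l. descent d l u b"
        "\<forall>u. u \<notin> A \<longrightarrow> nf u = xpow u"
        "\<forall>h\<in>J. (\<Sum>v\<in>keys h. cpoly (coef h v) * nf v) = 0"
      by (rule initial_set_normal_forms[OF init J])
    note nf = nf'[rule_format]
    \<comment> \<open>The coefficient of the dual monomial of \<open>a\<close> in \<open>g\<close> is the value of the functional at \<open>a\<close>.\<close>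
    define g :: "('n, 'k) mpoly"
      where "g = (\<Sum>a | a \<le> corner r. Poly_Mapping.single a (coef (nf (corner r - a)) w))"
    have coef_g: "coef g a = (if a \<le> corner r then coef (nf (corner r - a)) w else 0)" for a
      unfolding g_def by (simp add: lookup_sum lookup_single when_def finite_below)
    have nf_outside: "nf b = 0" if "b \<in> outside_box r" for b
      using nf(4)[OF xpow_outside_box_in_ideal[OF J pow that]]
      by (simp add: coef_xpow cpoly_def)
    have annihilates: "coef (g * h) (corner r) = 0" if h: "h \<in> J" for h
    proof -
      have "(if b \<le> corner r then coef g (corner r - b) * coef h b else 0)
          = coef h b * coef (nf b) w" for b
      proof (cases "b \<le> corner r")
        case True
        then have "corner r - b \<le> corner r" "corner r - (corner r - b) = b"
          by (auto simp: vec_eq_iff less_eq_vec_def)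
        then show ?thesis
          using True by (simp add: coef_g)
      qed (use nf_outside box in simp)
      then have "coef (g * h) (corner r) = (\<Sum>b\<in>keys h. coef h b * coef (nf b) w)"
        by (simp add: coef_times)
      also have "\<dots> = coef (\<Sum>v\<in>keys h. cpoly (coef h v) * nf v) w"
        by (simp add: lookup_sum)
      finally show ?thesis
        using nf(4)[OF h] by simp
    qed
    have "g * h \<in> supported (outside_box r)" if h: "h \<in> J" for h
    proof (rule supportedI)
      fix v assume "v \<notin> outside_box r"
      then have "v \<le> corner r"
        using box by simp
      then have "corner r - v + v = corner r"
        by (auto simp: vec_eq_iff less_eq_vec_def)
      then have "coef (g * h) v = coef (g * (xpow (corner r - v) * h)) (corner r)"
        using coef_xpow_times[of "corner r - v" "g * h" v] by (simp add: ac_simps)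
      then show "coef (g * h) v = 0"
        using annihilates ideal_times[OF J h] by simp
    qed
    then have "g \<in> ?QJ"
      by (simp add: ideal_quotient_def)
    moreover have "coef g u \<noteq> 0"
      using ule nf(3)[OF \<open>w \<notin> A\<close>] by (simp add: coef_g coef_xpow flip: w_def)
    moreover have "\<exists>k. descent d k u a" if "a \<in> keys g" for a
    proof -
      have a: "a \<le> corner r" "w \<in> keys (nf (corner r - a))"
        using that by (auto simp: in_keys_iff coef_g split: if_splits)
      then obtain l where "descent d l (corner r - a) w"
        using nf(2) by blast
      then have "descent d l (a + (corner r - a)) (a + w)"
        by simp
      moreover have "a + (corner r - a) = corner r"
        using a(1) by (auto simp: vec_eq_iff less_eq_vec_def)
      ultimately have "descent d l (w + u) (w + a)"
        using uw by (simp add: add.commute)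
      then show ?thesis
        by auto
    qed
    ultimately show ?thesis
      unfolding tops_def by blast
  qed
qed

section \<open>Torus orbits and their closures\<close>

text \<open>The value at \<open>t\<close> of the character of the torus with weight \<open>u\<close>.\<close>

definition char_val :: "'k::field ^ 'n::finite \<Rightarrow> nat ^ 'n \<Rightarrow> 'k" where
  "char_val t u = (\<Prod>i\<in>UNIV. (t $ i) ^ (u $ i))"

lemma char_val_nonzero: "t \<in> torus \<Longrightarrow> char_val t u \<noteq> 0"
  by (simp add: char_val_def torus_def)

lemma coef_torus_act [simp]: "coef (torus_act t g) u = char_val t u * coef g u"
  by (simp add: torus_act_def char_val_def lookup_mapp when_def in_keys_iff)

lemma keys_torus_act: "t \<in> torus \<Longrightarrow> keys (torus_act t g) = keys g"
  by (auto simp: in_keys_iff char_val_nonzero)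

lemma torus_act_diff: "torus_act t (g - h) = torus_act t g - torus_act t h"
  by (rule poly_mapping_eqI) (simp add: lookup_minus right_diff_distrib)

lemma torus_act_torus_act: "torus_act s (torus_act t g) = torus_act (s * t) g"
  by (rule poly_mapping_eqI) (simp add: char_val_def power_mult_distrib prod.distrib)

lemma torus_times: "s \<in> torus \<Longrightarrow> t \<in> torus \<Longrightarrow> s * t \<in> torus"
  by (simp add: torus_def)

definition torus_inv :: "'k::field ^ 'n::finite \<Rightarrow> 'k ^ 'n" where
  "torus_inv t = (\<chi> i. inverse (t $ i))"

lemma torus_inv: "t \<in> torus \<Longrightarrow> torus_inv t \<in> torus"
  by (simp add: torus_def torus_inv_def)

lemma torus_inv_times:
  assumes "t \<in> torus"
  shows "torus_inv t * t = 1" "t * torus_inv t = 1"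
  using assms by (simp_all add: torus_def torus_inv_def vec_eq_iff)

lemma torus_act_1 [simp]: "torus_act 1 g = g"
  by (rule poly_mapping_eqI) (simp add: char_val_def)

lemma torus_act_inv:
  assumes "t \<in> torus"
  shows "torus_act (torus_inv t) (torus_act t g) = g" "torus_act t (torus_act (torus_inv t) g) = g"
  using assms by (simp_all add: torus_act_torus_act torus_inv_times)

lemma torus_orbit_torus_act:
  assumes t: "t \<in> torus"
  shows "torus_orbit (torus_act t ` J) = torus_orbit J"
proof
  show "torus_orbit (torus_act t ` J) \<subseteq> torus_orbit J"
    using t torus_times by (fastforce simp: torus_orbit_def image_image torus_act_torus_act)
  have "torus_act s ` J = torus_act (s * torus_inv t) ` torus_act t ` J" for s
    using t by (simp add: image_image torus_act_torus_act torus_inv_times mult.assoc)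
  then show "torus_orbit J \<subseteq> torus_orbit (torus_act t ` J)"
    unfolding torus_orbit_def using torus_times torus_inv[OF t] by blast
qed

text \<open>
  The monomials outside \<open>A\<close> form a basis of \<open>S/J\<close>. This is the condition for a point of the Hilbert
  scheme to lie in the chart of \<open>-A\<close>, but it can be transported along the torus action without
  reference to the Hilbert function.
\<close>

definition standard_basis :: "('n::finite, 'k::field) mpoly set \<Rightarrow> (nat ^ 'n) set \<Rightarrow> bool" where
  "standard_basis J A \<longleftrightarrow> (\<forall>g. \<exists>!p. keys p \<subseteq> - A \<and> g - p \<in> J)"

lemma standard_basis_torus_act:
  fixes J :: "('n::finite, 'k::field) mpoly set"
  assumes t: "t \<in> torus" and J: "standard_basis J A"
  shows "standard_basis (torus_act t ` J) A"
  unfolding standard_basis_def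
proof
  fix g :: "('n, 'k) mpoly"
  have shift: "g - p \<in> torus_act t ` J \<longleftrightarrow>
      torus_act (torus_inv t) g - torus_act (torus_inv t) p \<in> J" for p
  proof
    assume "g - p \<in> torus_act t ` J"
    then obtain j where "j \<in> J" "g - p = torus_act t j"
      by blast
    then show "torus_act (torus_inv t) g - torus_act (torus_inv t) p \<in> J"
      using t by (simp add: torus_act_inv flip: torus_act_diff)
  next
    assume "torus_act (torus_inv t) g - torus_act (torus_inv t) p \<in> J"
    then have "torus_act (torus_inv t) (g - p) \<in> J"
      by (simp add: torus_act_diff)
    then have "torus_act t (torus_act (torus_inv t) (g - p)) \<in> torus_act t ` J"
      by (rule imageI)
    then show "g - p \<in> torus_act t ` J"
      using t by (simp add: torus_act_inv)
  qed
  obtain p where p: "keys p \<subseteq> - A" "torus_act (torus_inv t) g - p \<in> J"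
    and uniq: "\<And>q. keys q \<subseteq> - A \<Longrightarrow> torus_act (torus_inv t) g - q \<in> J \<Longrightarrow> q = p"
    using J unfolding standard_basis_def by metis
  show "\<exists>!p. keys p \<subseteq> - A \<and> g - p \<in> torus_act t ` J"
  proof (rule ex1I)
    show "keys (torus_act t p) \<subseteq> - A \<and> g - torus_act t p \<in> torus_act t ` J"
      using p t by (simp add: keys_torus_act shift torus_act_inv)
  next
    fix q assume q: "keys q \<subseteq> - A \<and> g - q \<in> torus_act t ` J"
    then have "torus_act (torus_inv t) q = p"
      using t by (intro uniq) (simp_all add: keys_torus_act torus_inv shift)
    then show "q = torus_act t p"
      using t by (auto simp: torus_act_inv)
  qed
qed

lemma coord_eq:
  assumes J: "standard_basis J A" and p: "keys p \<subseteq> - A" "xpow u - p \<in> J"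
  shows "coord (- A) u b J = coef p b"
proof -
  have "(THE p. keys p \<subseteq> - A \<and> xpow u - p \<in> J) = p"
    using J p unfolding standard_basis_def by (intro the1_equality) auto
  then show ?thesis
    by (simp add: coord_def)
qed

lemma coord_torus_act:
  fixes J :: "('n::finite, 'k::field) mpoly set"
  assumes t: "t \<in> torus" and id: "is_ideal J" and J: "standard_basis J A"
  shows "char_val t u * coord (- A) u b (torus_act t ` J) = char_val t b * coord (- A) u b J"
proof -
  obtain p :: "('n, 'k) mpoly" where p: "keys p \<subseteq> - A" "xpow u - p \<in> J"
    using J unfolding standard_basis_def by metis
  define q where "q = cpoly (inverse (char_val t u)) * torus_act t p"
  have "keys q \<subseteq> - A"
    using p(1) by (auto simp: q_def in_keys_iff)
  moreover have "xpow u - q = torus_act t (cpoly (inverse (char_val t u)) * (xpow u - p))"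
    using char_val_nonzero[OF t]
    by (intro poly_mapping_eqI)
      (simp add: q_def lookup_minus coef_xpow right_diff_distrib mult.left_commute)
  then have "xpow u - q \<in> torus_act t ` J"
    using ideal_times[OF id p(2)] by simp
  ultimately have "coord (- A) u b (torus_act t ` J) = coef q b"
    by (rule coord_eq[OF standard_basis_torus_act[OF t J]])
  then show ?thesis
    using char_val_nonzero[OF t] coord_eq[OF J p] by (simp add: q_def)
qed

lemma regular_functions_power: "F \<in> regular_functions B \<Longrightarrow> (\<lambda>I. F I ^ n) \<in> regular_functions B"
  by (induction n) (auto intro: regular_functions.intros)

lemma standard_basis_supported: "standard_basis (supported A :: ('n::finite, 'k::field) mpoly set) A"
  unfolding standard_basis_def
proof
  fix g :: "('n, 'k) mpoly"
  define p where "p = Poly_Mapping.mapp (\<lambda>u a. if u \<in> A then 0 else a) g"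
  have p: "coef p u = (if u \<in> A then 0 else coef g u)" for u
    by (simp add: p_def lookup_mapp when_def in_keys_iff)
  show "\<exists>!p. keys p \<subseteq> - A \<and> g - p \<in> supported A"
  proof (rule ex1I)
    show "keys p \<subseteq> - A \<and> g - p \<in> supported A"
      by (auto simp: in_keys_iff p lookup_minus intro: supportedI split: if_splits)
  next
    fix q assume q: "keys q \<subseteq> - A \<and> g - q \<in> supported A"
    show "q = p"
    proof (rule poly_mapping_eqI)
      fix u
      show "coef q u = coef p u"
      proof (cases "u \<in> A")
        case True
        then have "u \<notin> keys q"
          using q by blast
        then show ?thesis
          using True by (simp add: p in_keys_iff)
      next
        case False
        then show ?thesis
          using q supportedD[of "g - q" A u] by (simp add: p lookup_minus)
      qed
    qed
  qed
qed

text \<open>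
  A point of the closure of a set is seen by the principal open subsets of the charts that contain
  it. A monomial ideal lies in the chart of its standard monomials.
\<close>

lemma supported_in_closure:
  fixes A :: "(nat ^ 'n::finite) set" and \<O> :: "('n, 'k::field) mpoly set set"
  assumes cl: "supported A \<in> zariski c H closure_of \<O>"
    and F: "F \<in> regular_functions (- A)" "F (supported A) \<noteq> 0"
  shows "\<exists>I\<in>\<O>. I \<in> chart c H (- A) \<and> F I \<noteq> 0"
proof -
  have top: "(supported A :: ('n, 'k) mpoly set) \<in> topspace (zariski c H)"
    and op: "\<And>U. (supported A :: ('n, 'k) mpoly set) \<in> U \<Longrightarrow> openin (zariski c H) U \<Longrightarrow> \<exists>y. y \<in> \<O> \<and> y \<in> U"
    using cl unfolding in_closure_of by auto
  have "(supported A :: ('n, 'k) mpoly set) \<in> hilb c H"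
    using top unfolding zariski_def topology_generated_by_topspace chart_def by auto
  then have chart: "(supported A :: ('n, 'k) mpoly set) \<in> chart c H (- A)"
    using standard_basis_supported[of A] by (simp add: chart_def standard_basis_def)
  have "openin (zariski c H) {I \<in> chart c H (- A). F I \<noteq> 0}"
    unfolding zariski_def by (rule topology_generated_by_Basis) (use F(1) in auto)
  then show ?thesis
    using op[of "{I \<in> chart c H (- A). F I \<noteq> 0}"] chart F(2) by auto
qed

lemma coef_hom_component:
  fixes g :: "('n::finite, 'k::field) mpoly"
  shows "coef (hom_component c a g) v = (if mdeg c v = a then coef g v else 0)"
  by (auto simp: hom_component_def lookup_sum lookup_single when_def in_keys_iff)

text \<open>
  The component of a normal form in the degree of the monomial is again a normal form, hence by
  uniqueness all of it.
\<close>

lemma normal_form_homogeneous: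
  fixes J :: "('n::finite, 'k::field) mpoly set"
  assumes hom: "homogeneous_ideal c J" and J: "standard_basis J A"
    and p: "keys p \<subseteq> - A" "xpow u - p \<in> J" and b: "b \<in> keys p"
  shows "mdeg c b = mdeg c u"
proof -
  define q where "q = hom_component c (mdeg c u) p"
  have q: "coef q v = (if mdeg c v = mdeg c u then coef p v else 0)" for v
    by (simp add: q_def coef_hom_component)
  have "mdeg c u \<in> deg_group c"
    by (simp add: mdeg_def deg_group_def quotientI)
  then have "hom_component c (mdeg c u) (xpow u - p) \<in> J"
    using hom p(2) unfolding homogeneous_ideal_def by blast
  moreover have "hom_component c (mdeg c u) (xpow u - p) = xpow u - q"
    by (rule poly_mapping_eqI) (auto simp: coef_hom_component lookup_minus q coef_xpow)
  moreover have "keys q \<subseteq> - A"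
    using p(1) by (auto simp: in_keys_iff q split: if_splits)
  ultimately have "q = p"
    using J p unfolding standard_basis_def by metis
  then show ?thesis
    using b q[of b] by (auto simp: in_keys_iff split: if_splits)
qed

text \<open>
  The coordinate of \<open>t \<cdot> J\<close> that belongs to \<open>u\<close> and \<open>b\<close> is the coordinate of \<open>J\<close> multiplied by the
  value at \<open>t\<close> of the character of weight \<open>b - u\<close>, a multiple of \<open>c\<close>. If coordinates for an ascending
  and a descending pair were both nonzero, then suitable powers of them would have a product that is a
  nonzero constant on the orbit, by homogeneity, although every such coordinate vanishes at the
  monomial ideal in the closure of the orbit.
\<close>

lemma initial_set_of_closure:
  fixes J :: "('n::finite, 'k::field) mpoly set"
  assumes hom: "homogeneous_ideal c J" and J: "standard_basis J A"
    and cl: "supported A \<in> zariski c H closure_of torus_orbit J"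
  shows "initial_set c J A \<or> initial_set (- c) J A"
proof (rule ccontr)
  assume neither: "\<not> (initial_set c J A \<or> initial_set (- c) J A)"
  have id: "is_ideal J"
    using hom by (simp add: homogeneous_ideal_def)
  have "p = 0" if "p \<in> J" "keys p \<subseteq> - A" for p
  proof -
    have "\<exists>!q. keys q \<subseteq> - A \<and> p - q \<in> J"
      using J by (simp add: standard_basis_def)
    moreover have "p - p \<in> J"
      using id by (simp add: is_ideal_iff)
    moreover have "p - 0 \<in> J" "keys (0 :: ('n, 'k) mpoly) \<subseteq> - A"
      using that(1) by simp_all
    ultimately show ?thesis
      using that(2) by blast
  qed
  then have indep: "\<forall>p\<in>J. keys p \<subseteq> - A \<longrightarrow> p = 0"
    by blast
  \<comment> \<open>If \<open>d\<close> is not the common direction, some normal form has a term that lies above its monomial.\<close>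
  have bad: "\<exists>u\<in>A. \<exists>b l. b \<notin> A \<and> l > 0 \<and> descent d l b u \<and> coord (- A) u b J \<noteq> 0"
    if d: "d \<in> {c, - c}" and no: "\<not> initial_set d J A" for d
  proof -
    have "\<not> (\<forall>u\<in>A. \<exists>p. keys p \<subseteq> - A \<and> (\<forall>b\<in>keys p. \<exists>l>0. descent d l u b) \<and> xpow u - p \<in> J)"
      using no indep unfolding initial_set_def by simp
    then obtain u where u: "u \<in> A"
      and no': "\<not> (\<exists>p. keys p \<subseteq> - A \<and> (\<forall>b\<in>keys p. \<exists>l>0. descent d l u b) \<and> xpow u - p \<in> J)"
      by blast
    obtain p :: "('n, 'k) mpoly" where p: "keys p \<subseteq> - A" "xpow u - p \<in> J"
      using J unfolding standard_basis_def by metis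
    then have "\<not> (\<forall>b\<in>keys p. \<exists>l>0. descent d l u b)"
      using no' by blast
    then obtain b where b: "b \<in> keys p" "\<not> (\<exists>l>0. descent d l u b)"
      by blast
    have "b \<noteq> u"
      using b(1) p(1) u by blast
    obtain k where k: "int_vec u - int_vec b = k *s c"
      using mdeg_eq_imp[OF normal_form_homogeneous[OF hom J p b(1)]] by blast
    obtain m where m: "int_vec u - int_vec b = m *s d"
    proof (cases "d = c")
      case False
      have "k *s c = (- k) *s (- c)"
        by (simp add: vec_eq_iff)
      then show thesis
        using that[of "- k"] k d False by auto
    qed (use k in \<open>auto intro: that\<close>)
    have "m < 0"
    proof (rule ccontr)
      assume "\<not> m < 0"
      then have "descent d (nat m) u b"
        using m by (simp add: descent_def)
      then have "nat m = 0"
        using b(2) by (metis gr0I)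
      then show False
        using \<open>descent d (nat m) u b\<close> \<open>b \<noteq> u\<close> by simp
    qed
    have "int_vec b - int_vec u = - (m *s d)"
      unfolding m[symmetric] by simp
    also have "\<dots> = (- m) *s d"
      by (simp add: vec_eq_iff)
    finally have "descent d (nat (- m)) b u"
      using \<open>m < 0\<close> by (simp add: descent_def)
    moreover have "coord (- A) u b J \<noteq> 0"
      using b(1) by (simp add: coord_eq[OF J p] in_keys_iff)
    ultimately show ?thesis
      using u b(1) p(1) \<open>m < 0\<close> by (intro bexI[of _ u] exI[of _ b] exI[of _ "nat (- m)"]) auto
  qed
  obtain u b m where u: "u \<in> A" "b \<notin> A" "m > 0" "descent c m b u" "coord (- A) u b J \<noteq> 0"
    using bad[of c] neither by auto
  obtain v e l where v: "v \<in> A" "e \<notin> A" "l > 0" "descent c l v e" "coord (- A) v e J \<noteq> 0"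
    using bad[of "- c"] neither by (auto simp: descent_uminus)
  \<comment> \<open>The two weights are \<open>m c\<close> and \<open>-l c\<close>, so that they cancel in these powers.\<close>
  define F :: "('n, 'k) mpoly set \<Rightarrow> 'k"
    where "F I = coord (- A) u b I ^ l * coord (- A) v e I ^ m" for I
  have F: "F \<in> regular_functions (- A)"
    unfolding F_def using u(2) v(2)
    by (intro regular_functions.mult regular_functions_power regular_functions.coord) auto
  have "F J \<noteq> 0"
    using u(5) v(5) by (simp add: F_def)
  have orbit: "F (torus_act t ` J) = F J" if t: "t \<in> torus" for t
  proof -
    have exps: "u $ i * l + v $ i * m = b $ i * l + e $ i * m" for i
    proof -
      have "int (b $ i) * l = (int (u $ i) + int m * c $ i) * l"
        using descent_nth[OF u(4), of i] by simp
      moreover have "int (v $ i) * m = (int (e $ i) + int l * c $ i) * m"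
        using descent_nth[OF v(4), of i] by simp
      ultimately have "int (u $ i) * l + int (v $ i) * m = int (b $ i) * l + int (e $ i) * m"
        by (simp add: algebra_simps)
      then have "int (u $ i * l + v $ i * m) = int (b $ i * l + e $ i * m)"
        by simp
      then show ?thesis
        by (simp only: of_nat_eq_iff)
    qed
    have char: "char_val t x ^ l * char_val t y ^ m = (\<Prod>i\<in>UNIV. (t $ i) ^ (x $ i * l + y $ i * m))"
      for x y
      by (simp add: char_val_def prod_power_distrib power_mult power_add prod.distrib)
    define \<kappa> where "\<kappa> = char_val t u ^ l * char_val t v ^ m"
    have "\<kappa> * F (torus_act t ` J) =
        (char_val t u * coord (- A) u b (torus_act t ` J)) ^ l *
        (char_val t v * coord (- A) v e (torus_act t ` J)) ^ m"
      by (simp add: \<kappa>_def F_def power_mult_distrib)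
    also have "\<dots> = (char_val t b ^ l * char_val t e ^ m) * F J"
      unfolding coord_torus_act[OF t id J] by (simp add: F_def power_mult_distrib)
    also have "char_val t b ^ l * char_val t e ^ m = \<kappa>"
      unfolding \<kappa>_def char exps ..
    finally show ?thesis
      using char_val_nonzero[OF t] by (simp add: \<kappa>_def)
  qed
  have "coord (- A) u b (supported A :: ('n, 'k) mpoly set) = 0"
    using u(1) coord_eq[OF standard_basis_supported, of 0 A u b] by (simp add: supported_def)
  then have "F (supported A) = 0"
    using v(3) by (simp add: F_def)
  then have "\<exists>I\<in>torus_orbit J. I \<in> chart c H (- A) \<and> F I + (- F J) \<noteq> 0"
    using \<open>F J \<noteq> 0\<close> by (intro supported_in_closure[OF cl] regular_functions.add F regular_functions.const) simp
  then show False
    using orbit by (auto simp: torus_orbit_def)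
qed

lemma base_change_supported:
  assumes A: "up_closed A"
  shows "base_change (supported A :: ('n::finite, 'k::field) mpoly set) = supported A"
proof
  have "keys (Poly_Mapping.map to_ac g) \<subseteq> keys g" for g :: "('n, 'k) mpoly"
    by (auto simp: in_keys_iff map.rep_eq when_def split: if_splits)
  then show "base_change (supported A :: ('n, 'k) mpoly set) \<subseteq> supported A"
    unfolding base_change_def
    by (intro ideal_gen_minimal is_ideal_supported A) (auto simp: supported_def)
  have "Poly_Mapping.map to_ac (xpow u :: ('n, 'k) mpoly) = xpow u" for u
    by (simp add: xpow_def)
  then have "xpow u \<in> base_change (supported A :: ('n, 'k) mpoly set)" if "u \<in> A" for u
    unfolding base_change_def using that
    by (intro ideal_gen_base image_eqI[of _ _ "xpow u"]) (auto simp: supported_def)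
  then show "supported A \<subseteq> base_change (supported A :: ('n, 'k) mpoly set)"
    by (intro supported_subset_ideal) (auto simp: base_change_def is_ideal_ideal_gen)
qed

section \<open>Arrow maps along an edge\<close>

text \<open>
  A single ideal over the algebraic closure has both ends of an edge as initial ideals: translating
  a point \<open>J\<close> of the orbit by the torus changes neither the orbit nor the standard bases.
\<close>

lemma T_edge_initial_sets:
  fixes M N :: "('n::finite, 'k::field) mpoly set"
  assumes "T_edge c H M N"
  obtains J :: "('n, 'k alg_closure) mpoly set"
  where "is_ideal J" "initial_set c J (Mon M) \<or> initial_set (- c) J (Mon M)"
    "initial_set c J (Mon N) \<or> initial_set (- c) J (Mon N)"
proof -
  obtain I :: "('n, 'k) mpoly set" where M: "monomial_ideal M" and N: "monomial_ideal N"
    and cl: "base_change M \<in> zariski c H closure_of torus_orbit (base_change I)"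
      "base_change N \<in> zariski c H closure_of torus_orbit (base_change I)"
    using assms unfolding T_edge_def by blast
  define J0 where "J0 = base_change I"
  have bc: "base_change L = supported (Mon L)" if "monomial_ideal L" for L :: "('n, 'k) mpoly set"
    using base_change_supported monomial_ideal_supported[OF that] by metis
  have clM: "supported (Mon M) \<in> zariski c H closure_of torus_orbit J0"
    and clN: "supported (Mon N) \<in> zariski c H closure_of torus_orbit J0"
    using cl unfolding J0_def bc[OF M] bc[OF N] by auto
  have meets: "\<exists>t\<in>torus. torus_act t ` J0 \<in> chart c H (- A)"
    if "supported A \<in> zariski c H closure_of torus_orbit J0" for A
    using supported_in_closure[OF that regular_functions.const[of 1]] by (auto simp: torus_orbit_def)
  obtain s where s: "s \<in> torus" "torus_act s ` J0 \<in> chart c H (- Mon M)"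
    using meets[OF clM] by blast
  obtain t where t: "t \<in> torus" "torus_act t ` J0 \<in> chart c H (- Mon N)"
    using meets[OF clN] by blast
  define J where "J = torus_act s ` J0"
  have orbit: "torus_orbit J = torus_orbit J0"
    unfolding J_def by (rule torus_orbit_torus_act[OF s(1)])
  have hom: "homogeneous_ideal c J" and JM: "standard_basis J (Mon M)"
    using s(2) by (simp_all add: J_def chart_def hilb_def standard_basis_def)
  have "J = torus_act (s * torus_inv t) ` torus_act t ` J0"
    using t(1) by (simp add: J_def image_image torus_act_torus_act torus_inv_times mult.assoc)
  moreover have "standard_basis (torus_act t ` J0) (Mon N)"
    using t(2) by (simp add: chart_def standard_basis_def)
  ultimately have JN: "standard_basis J (Mon N)"
    using standard_basis_torus_act torus_times[OF s(1) torus_inv[OF t(1)]] by metis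
  show thesis
  proof (rule that)
    show "is_ideal J"
      using hom by (simp add: homogeneous_ideal_def)
    show "initial_set c J (Mon M) \<or> initial_set (- c) J (Mon M)"
      using clM orbit by (intro initial_set_of_closure[OF hom JM]) simp
    show "initial_set c J (Mon N) \<or> initial_set (- c) J (Mon N)"
      using clN orbit by (intro initial_set_of_closure[OF hom JN]) simp
  qed
qed

theorem theorem1p3:
  fixes c :: "int ^ 'n::finite"
    and H :: "(int ^ 'n) set \<Rightarrow> nat"
    and M N :: "('n, 'k::field) mpoly set"
  assumes "finite {a \<in> deg_group c. H a \<noteq> 0}"
    and "monomial_ideal M" and "M \<in> hilb c H"
    and "monomial_ideal N" and "N \<in> hilb c H"
    and "T_edge c H M N"
  shows "\<exists>leq. term_order leq \<and>
    (\<exists>f. arrow_map c leq M N f) \<and>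
    (\<forall>r :: 'n \<Rightarrow> nat. (\<forall>i. xpow (axis i (r i)) \<in> M \<inter> N) \<longrightarrow>
       (\<exists>fhat. arrow_map c leq
          (ideal_quotient (ideal_gen (range (\<lambda>i. xpow (axis i (r i))))) M)
          (ideal_quotient (ideal_gen (range (\<lambda>i. xpow (axis i (r i))))) N) fhat))"
proof -
  note M = monomial_ideal_supported[OF \<open>monomial_ideal M\<close>]
  note N = monomial_ideal_supported[OF \<open>monomial_ideal N\<close>]
  obtain J :: "('n, 'k alg_closure) mpoly set" where J: "is_ideal J"
    and init: "initial_set c J (Mon M) \<or> initial_set (- c) J (Mon M)"
      "initial_set c J (Mon N) \<or> initial_set (- c) J (Mon N)"
    using T_edge_initial_sets[OF \<open>T_edge c H M N\<close>] .
  have "M \<noteq> N"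
    using \<open>T_edge c H M N\<close> by (simp add: T_edge_def)
  then have "Mon M \<noteq> Mon N"
    using M(2) N(2) by metis
  then obtain d p q where d: "d \<in> {c, - c}" and dM: "initial_set d J (Mon M)"
    and dN: "initial_set (- d) J (Mon N)" and pq: "d $ p > 0" "d $ q < 0"
    using opposite_directions[OF J M(1) N(1) _ init] by blast
  have d0: "d \<noteq> 0" "- d \<noteq> 0"
    using pq by auto
  obtain leq where leq': "term_order leq" "\<forall>l u v. descent d l u v \<longrightarrow> leq v u"
    by (rule term_order_ascending[OF pq(1)])
  note leq = leq'[rule_format]
  have "arrow_map c leq M N (partner d J)"
    using tops_initial_set[OF dM J d0(1)] tops_initial_set[OF dN J d0(2)]
    by (intro arrow_map_of_tops[OF J d0(1) d _ _ leq(2)]) simp_all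
  moreover have "\<exists>fhat. arrow_map c leq
      (ideal_quotient (ideal_gen (range (\<lambda>i. xpow (axis i (r i))))) M)
      (ideal_quotient (ideal_gen (range (\<lambda>i. xpow (axis i (r i))))) N) fhat"
    if r: "\<forall>i. xpow (axis i (r i)) \<in> M \<inter> N" for r :: "'n \<Rightarrow> nat"
  proof -
    let ?Q = "supported (outside_box r)"
    have pow: "xpow (axis i (r i)) \<in> J" for i
      using r by (intro common_power_in_ideal[OF dM dN pq]) (auto simp: Mon_def)
    have Mon_quot: "Mon (ideal_quotient ?Q L) = {u. \<forall>v\<in>Mon L. u + v \<in> outside_box r}"
      if "L = supported (Mon L)" for L :: "('n, 'k) mpoly set"
      by (subst that) (rule Mon_ideal_quotient_supported)
    have "arrow_map c leq (ideal_quotient ?Q M) (ideal_quotient ?Q N) (partner d (ideal_quotient ?Q J))"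
    proof (rule arrow_map_of_tops[OF _ d0(1) d _ _ leq(2)])
      show "is_ideal (ideal_quotient ?Q J)"
        by (intro is_ideal_ideal_quotient is_ideal_supported up_closed_outside_box J)
      show "Mon (ideal_quotient ?Q M) = tops d (ideal_quotient ?Q J)"
        unfolding Mon_quot[OF M(2)] tops_ideal_quotient[OF dM J d0(1) pow] ..
      show "Mon (ideal_quotient ?Q N) = tops (- d) (ideal_quotient ?Q J)"
        unfolding Mon_quot[OF N(2)] tops_ideal_quotient[OF dN J d0(2) pow] ..
    qed
    then show ?thesis
      unfolding ideal_gen_powers by blast
  qed
  ultimately show ?thesis
    using leq(1) by blast
qed

end
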